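(* Fix $\lambda>0$ and $z>0$. The process $\xi^{\lambda,z}$ is a time-homogeneous Markov process with respect to its natural filtration, with transition kernels given, for $t>0$ and $x\in\mathbb{R}$, by $$P_t(x,\mathrm{d}y)=\Big\{\big[\mathbb{I}_{\{x=z\}}+q_t(x)\,\mathbb{I}_{\{x\neq z\}}\big]\mathbb{I}_{\{y=z\}}+\big[p(t,y-x,\lambda t)\,e^{-\lambda\alpha(z,y)}\,e^{\lambda\alpha(z,x)}\,\mathbb{I}_{\{x\neq z\}}\big]\mathbb{I}_{\{y\neq z\}}\Big\}\,\varrho(\mathrm{d}y),$$ where $$q_t(x)=\Phi\Big(\lambda\sqrt{t}-\frac{|z-x|}{\sqrt{t}}\Big)-e^{2\lambda|z-x|}\,\Phi\Big(-\lambda\sqrt{t}-\frac{|z-x|}{\sqrt{t}}\Big),$$ $\alpha(z,x)=|z-x|-(z-x)$, $\Phi$ is the standard normal distribution function, and $\varrho(\mathrm{d}y)=\delta_z(\mathrm{d}y)+\mathrm{d}y$ on $\mathcal{B}(\mathbb{R})$. However, $\xi^{\lambda,z}$ is not a strong Markov process.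
   Context: Let $B=(B_t)_{t\ge 0}$ be a standard Brownian motion started at $0$ on a complete probability space $(\Omega,\mathcal{F},\mathbb{P})$. For $\lambda>0$, $z>0$, put $B^\lambda_t=B_t+\lambda t$, $\sigma_z^\lambda=\sup\{t>0: B^\lambda_t=z\}$ (almost surely finite), and $\xi^{\lambda,z}_t=B^\lambda_{t\wedge\sigma_z^\lambda}$, $t\ge 0$. For $t>0$, $p(t,x,y)=\frac{1}{\sqrt{2\pi t}}\exp\big(-\frac{(x-y)^2}{2t}\big)$ is the Gaussian density in $x$ with mean $y$ and variance $t$. The natural filtration is $\mathcal{F}^{\xi^{\lambda,z}}_t=\sigma(\xi^{\lambda,z}_s, s\le t)$. The strong Markov property means: for every stopping time $T$ of this filtration, every $t\ge 0$ and every bounded measurable $f$, $\mathbb{E}[f(\xi^{\lambda,z}_{T+t})\mid\mathcal{F}^{\xi^{\lambda,z}}_T]=P_tf(\xi^{\lambda,z}_T)$ a.s. on $\{T<\infty\}$, where $P_tf(x)=\int f(y)P_t(x,\mathrm{d}y)$ and $P_0$ is the identity. *)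

theory Defs
  imports "HOL-Probability.Probability"
begin

section \<open>Brownian motion, last passage time and the stopped process\<close>

text \<open>All processes are indexed by \<open>t \<ge> 0\<close>; their values at negative times are irrelevant.
  Every path is continuous, whereas \<open>B\<^sub>0 = 0\<close> is only required almost surely.\<close>

definition brownian_motion :: "'a measure \<Rightarrow> (real \<Rightarrow> 'a \<Rightarrow> real) \<Rightarrow> bool" where
  "brownian_motion M B \<longleftrightarrow>
     prob_space M \<and>
     (\<forall>t\<ge>0. B t \<in> borel_measurable M) \<and>
     (AE \<omega> in M. B 0 \<omega> = 0) \<and>
     (\<forall>\<omega>\<in>space M. continuous_on {0..} (\<lambda>t. B t \<omega>)) \<and>
     (\<forall>s t. 0 \<le> s \<and> s < t \<longrightarrow>
        distributed M lborel (\<lambda>\<omega>. B t \<omega> - B s \<omega>) (normal_density 0 (sqrt (t - s)))) \<and>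
     (\<forall>(n::nat) (t :: nat \<Rightarrow> real). 0 \<le> t 0 \<and> (\<forall>i<n. t i < t (Suc i)) \<longrightarrow>
        prob_space.indep_vars M (\<lambda>_. borel) (\<lambda>i \<omega>. B (t (Suc i)) \<omega> - B (t i) \<omega>) {..<n})"

definition drifted :: "(real \<Rightarrow> 'a \<Rightarrow> real) \<Rightarrow> real \<Rightarrow> real \<Rightarrow> 'a \<Rightarrow> real" where
  "drifted B lam t \<omega> = B t \<omega> + lam * t"

text \<open>The supremum is taken in \<open>[0, \<infinity>]\<close>: it is \<open>\<infinity>\<close> on unbounded sets, and \<open>0\<close> on the empty set.\<close>

definition last_passage :: "(real \<Rightarrow> 'a \<Rightarrow> real) \<Rightarrow> real \<Rightarrow> real \<Rightarrow> 'a \<Rightarrow> ennreal" where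
  "last_passage B lam z \<omega> = Sup {ennreal t |t. t > 0 \<and> drifted B lam t \<omega> = z}"

definition stopped_process :: "(real \<Rightarrow> 'a \<Rightarrow> real) \<Rightarrow> real \<Rightarrow> real \<Rightarrow> real \<Rightarrow> 'a \<Rightarrow> real" where
  "stopped_process B lam z t \<omega> = drifted B lam (enn2real (min (ennreal t) (last_passage B lam z \<omega>))) \<omega>"

section \<open>Markov and strong Markov property\<close>

text \<open>The filtration is indexed by \<open>[0, \<infinity>]\<close>, with the \<open>\<sigma>\<close>-algebra generated by the whole process at
  \<open>\<infinity>\<close>, so that \<open>stopping_time\<close> covers stopping times with values in \<open>[0, \<infinity>]\<close>. No null sets
  are added.\<close>

definition natural_filtration :: "'a measure \<Rightarrow> (real \<Rightarrow> 'a \<Rightarrow> real) \<Rightarrow> ennreal \<Rightarrow> 'a measure" where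
  "natural_filtration M X t =
     sigma (space M) {X s -` A \<inter> space M |s A. 0 \<le> s \<and> ennreal s \<le> t \<and> A \<in> sets borel}"

definition bounded_measurable :: "(real \<Rightarrow> real) \<Rightarrow> bool" where
  "bounded_measurable f \<longleftrightarrow> f \<in> borel_measurable borel \<and> (\<exists>C. \<forall>x. \<bar>f x\<bar> \<le> C)"

definition transition_function :: "(real \<Rightarrow> real \<Rightarrow> real measure) \<Rightarrow> bool" where
  "transition_function P \<longleftrightarrow>
     (\<forall>t\<ge>0. P t \<in> borel \<rightarrow>\<^sub>M prob_algebra borel) \<and>
     (\<forall>x. P 0 x = return borel x) \<and>
     (\<forall>s\<ge>0. \<forall>t\<ge>0. \<forall>x. \<forall>A\<in>sets borel.
        emeasure (P (s + t) x) A = (\<integral>\<^sup>+ y. emeasure (P t y) A \<partial>P s x))"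

definition markov_process ::
    "'a measure \<Rightarrow> (real \<Rightarrow> 'a \<Rightarrow> real) \<Rightarrow> (real \<Rightarrow> real \<Rightarrow> real measure) \<Rightarrow> bool" where
  "markov_process M X P \<longleftrightarrow>
     (\<forall>t\<ge>0. X t \<in> borel_measurable M) \<and>
     transition_function P \<and>
     (\<forall>s\<ge>0. \<forall>t\<ge>0. \<forall>f. bounded_measurable f \<longrightarrow>
        (AE \<omega> in M. real_cond_exp M (natural_filtration M X (ennreal s)) (\<lambda>\<omega>. f (X (s + t) \<omega>)) \<omega>
           = (\<integral>y. f y \<partial>P t (X s \<omega>))))"

text \<open>The conditional expectation of \<open>f (X\<^bsub>T+t\<^esub>)\<close> matters on \<open>T < \<infinity>\<close> only. That event belongs
  to the \<open>\<sigma>\<close>-algebra of \<open>T\<close>, so the value \<open>0\<close> chosen on its complement has no effect.\<close>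

definition strong_markov ::
    "'a measure \<Rightarrow> (real \<Rightarrow> 'a \<Rightarrow> real) \<Rightarrow> (real \<Rightarrow> real \<Rightarrow> real measure) \<Rightarrow> bool" where
  "strong_markov M X P \<longleftrightarrow>
     (\<forall>T. stopping_time (natural_filtration M X) T \<longrightarrow>
       (\<forall>t\<ge>0. \<forall>f. bounded_measurable f \<longrightarrow>
         (AE \<omega> in M. T \<omega> < \<infinity> \<longrightarrow>
           real_cond_exp M (filtration.pre_sigma (space M) (natural_filtration M X) T)
               (\<lambda>\<omega>. if T \<omega> < \<infinity> then f (X (enn2real (T \<omega>) + t) \<omega>) else 0) \<omega>
             = (\<integral>y. f y \<partial>P t (X (enn2real (T \<omega>)) \<omega>)))))"

section \<open>The transition kernels\<close>

definition gauss_p :: "real \<Rightarrow> real \<Rightarrow> real \<Rightarrow> real" where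
  "gauss_p t x y = 1 / sqrt (2 * pi * t) * exp (- (x - y)\<^sup>2 / (2 * t))"

definition Phi :: "real \<Rightarrow> real" where
  "Phi = cdf std_normal_distribution"

definition alpha :: "real \<Rightarrow> real \<Rightarrow> real" where
  "alpha z x = \<bar>z - x\<bar> - (z - x)"

definition q_fun :: "real \<Rightarrow> real \<Rightarrow> real \<Rightarrow> real \<Rightarrow> real" where
  "q_fun lam z t x =
     Phi (lam * sqrt t - \<bar>z - x\<bar> / sqrt t)
       - exp (2 * lam * \<bar>z - x\<bar>) * Phi (- lam * sqrt t - \<bar>z - x\<bar> / sqrt t)"

definition rho :: "real \<Rightarrow> real measure" where
  "rho z = measure_of UNIV (sets borel) (\<lambda>A. emeasure (return borel z) A + emeasure lborel A)"

lemma sets_rho [simp, measurable_cong]: "sets (rho z) = sets borel"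
  by (simp add: rho_def sets.sigma_sets_eq[of borel, simplified])

lemma space_rho [simp]: "space (rho z) = UNIV"
  by (simp add: rho_def)

lemma emeasure_rho:
  assumes "A \<in> sets borel"
  shows "emeasure (rho z) A = emeasure (return borel z) A + emeasure lborel A"
proof (rule emeasure_measure_of[OF rho_def])
  show "countably_additive (sets (rho z)) (\<lambda>A. emeasure (return borel z) A + emeasure lborel A)"
    unfolding countably_additive_def
    by (auto simp: suminf_add[symmetric] suminf_emeasure simp del: emeasure_return)
qed (use assms in \<open>auto simp: positive_def\<close>)

definition kernel_density :: "real \<Rightarrow> real \<Rightarrow> real \<Rightarrow> real \<Rightarrow> real \<Rightarrow> real" where
  "kernel_density lam z t x y =
     (indicator {z} x + q_fun lam z t x * indicator (- {z}) x) * indicator {z} y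
     + (gauss_p t (y - x) (lam * t) * exp (- lam * alpha z y) * exp (lam * alpha z x)
          * indicator (- {z}) x) * indicator (- {z}) y"

definition trans_kernel :: "real \<Rightarrow> real \<Rightarrow> real \<Rightarrow> real \<Rightarrow> real measure" where
  "trans_kernel lam z t x =
     (if t = 0 then return borel x
      else density (rho z) (\<lambda>y. ennreal (kernel_density lam z t x y)))"

end

theory Submission
  imports Defs "HOL-Real_Asymp.Real_Asymp"
begin

text \<open>
  Let \<open>h x = min 1 (exp (- 2 lam (x - z)))\<close> be the probability that Brownian motion with drift \<open>lam\<close>, started in \<open>x\<close>, ever
  hits \<open>z\<close>. The last passage time exceeds \<open>u\<close> iff \<open>z\<close> is hit after \<open>u\<close>, which has conditional probability \<open>h (X\<^sub>u)\<close>
  given the past of \<open>X = drifted B lam\<close>. Before the last passage the stopped process is therefore the Doob \<open>h\<close>-transform of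
  \<open>X\<close>, and \<open>q\<^sub>t(x)\<close> is the mass that this transform loses, \<open>h(x) q\<^sub>t(x) = h(x) - E\<^sub>x[h(X\<^sub>t)]\<close>; afterwards the process
  rests in \<open>z\<close>.

  The hitting probability comes from the martingale \<open>exp (- 2 lam X)\<close>, stopped on finer and finer time grids, so that only
  discrete optional stopping is needed.

  At its first visit to \<open>z\<close> the process is in the state \<open>z\<close>, which the kernels make absorbing, yet with positive
  probability it exceeds \<open>z\<close> later on. Hence the strong Markov property fails at this stopping time.
\<close>

section \<open>Gaussian integrals and the transition kernels\<close>

text \<open>The last passage time is not a stopping time of the drifted motion, so there is no
  conditioning on the past at that time. The substitute works at a fixed time \<open>s\<close>: on
  \<open>hits_after s\<close> every event of the past of \<open>\<xi>\<close> coincides with an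
  event of \<open>F s\<close>, where independence of increments is available, and off
  \<open>hits_after s\<close> the process already rests in \<open>z\<close>.

  That the kernels make \<open>z\<close> absorbing agrees with the Markov property only because the
  drifted motion is at \<open>z\<close> with probability 0 at a fixed time: finding
  \<open>\<xi>\<close> in \<open>z\<close> then means that it rests there. A stopping time can meet
  \<open>z\<close> with visits still to come.

  The obstacle in the hitting estimate is the overshoot. Above \<open>z\<close> the martingale
  \<open>exp (2 * lam * (z - X))\<close> is bounded by 1, but on a grid the path may jump far below
  \<open>z\<close> before it is stopped. For a fixed horizon, continuity makes such jumps improbable
  as the mesh shrinks, and a crude second moment bound makes their contribution negligible. The
  horizon is removed afterwards, with the exponent \<open>lam\<close> in place of
  \<open>2 * lam\<close>, for which the mean decays in time.\<close>

lemma gauss_p_eq: "t > 0 \<Longrightarrow> gauss_p t (y - x) (lam * t) = normal_density (x + lam * t) (sqrt t) y"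
  by (simp add: gauss_p_def normal_density_def algebra_simps)

lemma nn_integral_normal_density [simp]:
  "\<sigma> > 0 \<Longrightarrow> (\<integral>\<^sup>+ y. ennreal (normal_density \<mu> \<sigma> y) \<partial>lborel) = 1"
  by (simp add: nn_integral_eq_integral)

text \<open>The factor \<open>\<sigma>\<close> is the Jacobian of the affine substitution. The
  reflected version serves to express upper tails by \<open>Phi\<close>.\<close>

lemma normal_density_rescale:
  "\<sigma> > 0 \<Longrightarrow> \<sigma> * normal_density \<mu> \<sigma> (\<mu> + \<sigma> * x) = std_normal_density x"
  "\<sigma> > 0 \<Longrightarrow> \<sigma> * normal_density \<mu> \<sigma> (\<mu> - \<sigma> * x) = std_normal_density x"
  by (simp_all add: normal_density_def real_sqrt_mult power_mult_distrib field_simps)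

lemma Phi_nonneg [simp]: "0 \<le> Phi a"
  by (simp add: Phi_def cdf_def)

lemma ennreal_Phi: "ennreal (Phi a) = (\<integral>\<^sup>+ y. ennreal (std_normal_density y) * indicator {..a} y \<partial>lborel)"
proof -
  interpret prob_space std_normal_distribution by (rule prob_space_normal_density) simp
  have "ennreal (Phi a) = emeasure std_normal_distribution {..a}"
    by (simp add: Phi_def cdf_def emeasure_eq_measure)
  then show ?thesis by (simp add: emeasure_density)
qed

lemma nn_integral_normal_atMost:
  assumes "\<sigma> > 0"
  shows "(\<integral>\<^sup>+ y. ennreal (normal_density \<mu> \<sigma> y) * indicator {..c} y \<partial>lborel) = ennreal (Phi ((c - \<mu>) / \<sigma>))"
proof -
  have "(\<integral>\<^sup>+ y. ennreal (normal_density \<mu> \<sigma> y) * indicator {..c} y \<partial>lborel)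
      = ennreal \<sigma> * (\<integral>\<^sup>+ x. ennreal (normal_density \<mu> \<sigma> (\<mu> + \<sigma> * x)) * indicator {..c} (\<mu> + \<sigma> * x) \<partial>lborel)"
    using nn_integral_real_affine[of "\<lambda>y. ennreal (normal_density \<mu> \<sigma> y) * indicator {..c} y" \<sigma> \<mu>] assms
    by simp
  also have "\<dots> = (\<integral>\<^sup>+ x. ennreal (std_normal_density x) * indicator {..(c - \<mu>) / \<sigma>} x \<partial>lborel)"
    using assms
    by (subst nn_integral_cmult[symmetric])
       (auto intro!: nn_integral_cong simp: normal_density_rescale[symmetric, OF assms, of _ \<mu>] indicator_def field_simps
         ennreal_mult'[symmetric])
  finally show ?thesis by (simp add: ennreal_Phi)
qed

lemma nn_integral_normal_greaterThan:
  assumes "\<sigma> > 0"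
  shows "(\<integral>\<^sup>+ y. ennreal (normal_density \<mu> \<sigma> y) * indicator {c<..} y \<partial>lborel) = ennreal (Phi ((\<mu> - c) / \<sigma>))"
proof -
  have "(\<integral>\<^sup>+ y. ennreal (normal_density \<mu> \<sigma> y) * indicator {c<..} y \<partial>lborel)
      = ennreal \<sigma> * (\<integral>\<^sup>+ x. ennreal (normal_density \<mu> \<sigma> (\<mu> - \<sigma> * x)) * indicator {c<..} (\<mu> - \<sigma> * x) \<partial>lborel)"
    using nn_integral_real_affine[of "\<lambda>y. ennreal (normal_density \<mu> \<sigma> y) * indicator {c<..} y" "-\<sigma>" \<mu>] assms
    by simp
  also have "\<dots> = (\<integral>\<^sup>+ x. ennreal (std_normal_density x) * indicator {..<(\<mu> - c) / \<sigma>} x \<partial>lborel)"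
    using assms
    by (subst nn_integral_cmult[symmetric])
       (auto intro!: nn_integral_cong simp: normal_density_rescale(2)[symmetric, OF assms, of _ \<mu>] indicator_def field_simps
         ennreal_mult'[symmetric])
  \<comment> \<open>The reflection produces an open lower ray, which differs from the closed one of
    \<open>ennreal_Phi\<close> by a single point.\<close>
  also have "\<dots> = (\<integral>\<^sup>+ x. ennreal (std_normal_density x) * indicator {..(\<mu> - c) / \<sigma>} x \<partial>lborel)"
    by (rule nn_integral_cong_AE, use AE_lborel_singleton[of "(\<mu> - c) / \<sigma>"] in eventually_elim)
       (auto simp: indicator_def)
  finally show ?thesis by (simp add: ennreal_Phi)
qed

lemma Phi_minus: "Phi (- a) = 1 - Phi a"
proof -
  have "(\<integral>\<^sup>+ y. ennreal (std_normal_density y) \<partial>lborel)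
      = (\<integral>\<^sup>+ y. ennreal (std_normal_density y) * indicator {..a} y \<partial>lborel)
      + (\<integral>\<^sup>+ y. ennreal (std_normal_density y) * indicator {a<..} y \<partial>lborel)"
    by (subst nn_integral_add[symmetric]) (auto simp: indicator_def intro!: nn_integral_cong simp del: nn_integral_normal_density)
  also have "\<dots> = ennreal (Phi a + Phi (-a))"
    using nn_integral_normal_atMost[of 1 0 a] nn_integral_normal_greaterThan[of 1 0 a] by simp
  finally show ?thesis

    by (simp add: ennreal_plus[symmetric] ennreal_1[symmetric] del: ennreal_1 ennreal_plus)
qed

text \<open>Written with \<open>alpha\<close> so that the exponential factors of
  \<open>kernel_density\<close> are literally the quotient of \<open>hit_prob\<close> at
  \<open>y\<close> and at \<open>x\<close>. Its meaning as a hitting probability is established in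
  \<open>emeasure_hits_after\<close>.\<close>

definition hit_prob :: "real \<Rightarrow> real \<Rightarrow> real \<Rightarrow> real" where
  "hit_prob lam z x = exp (- lam * alpha z x)"

lemma hit_prob_pos [simp]: "0 < hit_prob lam z x" "0 \<le> hit_prob lam z x" "hit_prob lam z x \<noteq> 0"
  by (simp_all add: hit_prob_def)

lemma hit_prob_below: "x \<le> z \<Longrightarrow> hit_prob lam z x = 1"
  by (simp add: hit_prob_def alpha_def)

lemma hit_prob_above: "z \<le> x \<Longrightarrow> hit_prob lam z x = exp (2 * lam * (z - x))"
  by (simp add: hit_prob_def alpha_def algebra_simps)

lemma hit_prob_le: "0 \<le> lam \<Longrightarrow> hit_prob lam z x \<le> 1" "0 \<le> lam \<Longrightarrow> hit_prob lam z x \<le> exp (2 * lam * (z - x))"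
   by (cases "x \<le> z"; simp add: hit_prob_below hit_prob_above mult_nonneg_nonpos)+

text \<open>The geometric mean of the two bounds in \<open>hit_prob_le\<close>. Along the drifted
  motion the mean of \<open>exp (- 2 * lam * X)\<close> is constant in time, whereas that of
  \<open>exp (- lam * X)\<close> decays, which is what makes late visits improbable.\<close>

lemma hit_prob_le_exp:
  assumes "0 \<le> lam" shows "hit_prob lam z x \<le> exp (lam * (z - x))"
proof (cases "x \<le> z")
  case False
  then have "lam * z \<le> lam * x" using assms by (intro mult_left_mono) auto
  then show ?thesis using False by (simp add: hit_prob_above algebra_simps)
qed (use assms in \<open>simp add: hit_prob_below\<close>)

lemma borel_measurable_hit_prob [measurable]: "hit_prob lam z \<in> borel_measurable borel"
  unfolding hit_prob_def[abs_def] alpha_def[abs_def] by measurable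

text \<open>Completing the square: tilting by \<open>exp (- 2 lam y)\<close> reverses the drift.\<close>

lemma normal_density_tilt:
  assumes "t > 0"
  shows "normal_density (x + lam * t) (sqrt t) y * exp (2 * lam * (z - y))
       = exp (2 * lam * (z - x)) * normal_density (x - lam * t) (sqrt t) y"
proof -
  have "- (y - (x + lam * t))\<^sup>2 / (2 * t) + 2 * lam * (z - y) = 2 * lam * (z - x) - (y - (x - lam * t))\<^sup>2 / (2 * t)"
    using assms by (simp add: field_simps power2_eq_square)
  then show ?thesis using assms
    by (simp add: normal_density_def flip: exp_add)
qed

text \<open>The right-hand side is the Gaussian mean of \<open>hit_prob\<close>, split at
  \<open>z\<close> into two tails. For \<open>x\<close> below \<open>z\<close> its terms match those
  of \<open>1 - q_fun\<close> directly; for \<open>x\<close> above \<open>z\<close> the factor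
  \<open>hit_prob\<close> cancels the exponential inside \<open>q_fun\<close>, and the two tails
  exchange their roles.\<close>

lemma q_fun_hit_prob:
  assumes "t > 0"
  shows "hit_prob lam z x * (1 - q_fun lam z t x)
     = Phi ((z - (x + lam * t)) / sqrt t) + exp (2 * lam * (z - x)) * Phi ((x - lam * t - z) / sqrt t)"
proof -
  define s where "s = sqrt t"
  have s: "s > 0" "t = s * s" using assms by (auto simp: s_def)
  show ?thesis
  proof (cases "x \<le> z")
    case True
    have "(z - (x + lam * t)) / s = - (lam * s - \<bar>z - x\<bar> / s)" "(x - lam * t - z) / s = - lam * s - \<bar>z - x\<bar> / s"
      using s True by (auto simp: field_simps)
    with True show ?thesis unfolding q_fun_def s_def[symmetric] by (simp add: hit_prob_below Phi_minus[of "lam * s - (z - x) / s", simplified])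
  next
    case False
    have 1: "(z - (x + lam * t)) / s = - lam * s - \<bar>z - x\<bar> / s"
      and 2: "(x - lam * t - z) / s = - (lam * s - \<bar>z - x\<bar> / s)"
      using s False by (auto simp: field_simps)
    have 3: "exp (2 * lam * (z - x)) * exp (2 * lam * \<bar>z - x\<bar>) = 1"
      using False by (simp add: algebra_simps flip: exp_add)
    have "hit_prob lam z x = exp (2 * lam * (z - x))" using False by (simp add: hit_prob_above)
    then have "hit_prob lam z x * (1 - q_fun lam z t x) = exp (2 * lam * (z - x)) * (1 - Phi (lam * s - \<bar>z - x\<bar> / s))
      + (exp (2 * lam * (z - x)) * exp (2 * lam * \<bar>z - x\<bar>)) * Phi (- lam * s - \<bar>z - x\<bar> / s)"
      unfolding q_fun_def s_def[symmetric] by (simp add: algebra_simps)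
    then show ?thesis
      unfolding s_def[symmetric] 1 2 3 Phi_minus by simp
  qed
qed

text \<open>Below \<open>z\<close> the weight is 1; above \<open>z\<close> tilting replaces it by a
  constant and reverses the drift. Each half is then a plain Gaussian tail.\<close>

lemma nn_integral_normal_hit_prob:
  assumes "t > 0"
  shows "(\<integral>\<^sup>+ y. ennreal (normal_density (x + lam * t) (sqrt t) y * hit_prob lam z y) \<partial>lborel)
       = ennreal (hit_prob lam z x * (1 - q_fun lam z t x))"
proof -
  have "(\<integral>\<^sup>+ y. ennreal (normal_density (x + lam * t) (sqrt t) y * hit_prob lam z y) \<partial>lborel)
      = (\<integral>\<^sup>+ y. ennreal (normal_density (x + lam * t) (sqrt t) y) * indicator {..z} y
          + ennreal (exp (2 * lam * (z - x))) * (ennreal (normal_density (x - lam * t) (sqrt t) y) * indicator {z<..} y) \<partial>lborel)"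
    using normal_density_tilt[OF assms, of x lam _ z]
    by (intro nn_integral_cong)
       (auto simp: indicator_def hit_prob_below hit_prob_above ennreal_mult'[symmetric])
  also have "\<dots> = ennreal (Phi ((z - (x + lam * t)) / sqrt t) + exp (2 * lam * (z - x)) * Phi ((x - lam * t - z) / sqrt t))"
    using assms
    by (simp add: nn_integral_add nn_integral_cmult nn_integral_normal_atMost nn_integral_normal_greaterThan
       ennreal_mult'[symmetric])
  finally show ?thesis using q_fun_hit_prob[OF assms] by simp
qed

text \<open>The Gaussian mean of \<open>hit_prob\<close> respects both bounds of the minimum that
  \<open>hit_prob\<close> is: 1 by total mass, the exponential by tilting. So it does not exceed
  \<open>hit_prob\<close> at the starting point, which makes \<open>q_fun\<close> nonnegative;
  nonnegativity of the mean gives the upper bound.\<close>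

lemma q_fun_bounds:
  assumes "t > 0" "lam \<ge> 0"
  shows "0 \<le> q_fun lam z t x" "q_fun lam z t x \<le> 1"
proof -
  have pos: "hit_prob lam z x * (1 - q_fun lam z t x) \<ge> 0"
    unfolding q_fun_hit_prob[OF assms(1)] by simp
  then show "q_fun lam z t x \<le> 1" by (subst (asm) zero_le_mult_iff) (smt (verit) hit_prob_pos(1))
  have "(\<integral>\<^sup>+ y. ennreal (normal_density (x + lam * t) (sqrt t) y * hit_prob lam z y) \<partial>lborel)
      \<le> (\<integral>\<^sup>+ y. ennreal (normal_density (x + lam * t) (sqrt t) y) \<partial>lborel)"
    using hit_prob_le(1)[OF assms(2)] by (intro nn_integral_mono ennreal_leI) (simp add: mult_left_le)
  then have 1: "hit_prob lam z x * (1 - q_fun lam z t x) \<le> 1"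
    using assms by (simp add: nn_integral_normal_hit_prob)
  have "(\<integral>\<^sup>+ y. ennreal (normal_density (x + lam * t) (sqrt t) y * hit_prob lam z y) \<partial>lborel)
      \<le> (\<integral>\<^sup>+ y. ennreal (exp (2 * lam * (z - x))) * ennreal (normal_density (x - lam * t) (sqrt t) y) \<partial>lborel)"
    using hit_prob_le(2)[OF assms(2)]
    by (intro nn_integral_mono) (simp add: mult_left_mono ennreal_mult'[symmetric] normal_density_tilt[OF assms(1), symmetric])
  then have 2: "hit_prob lam z x * (1 - q_fun lam z t x) \<le> exp (2 * lam * (z - x))"
    using assms by (simp add: nn_integral_normal_hit_prob nn_integral_cmult)
  have "hit_prob lam z x * (1 - q_fun lam z t x) \<le> hit_prob lam z x * 1"
    using 1 2 by (cases "x \<le> z") (auto simp: hit_prob_below hit_prob_above)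
  then show "0 \<le> q_fun lam z t x"
    by (subst (asm) mult_le_cancel_left_pos) auto
qed

section \<open>Integration against the transition kernels\<close>

lemma nn_integral_rho:
  assumes "f \<in> borel_measurable borel"
  shows "(\<integral>\<^sup>+ y. f y \<partial>rho z) = f z + (\<integral>\<^sup>+ y. f y \<partial>lborel)"
proof -
  note [simp] = measurable_cong_sets[OF sets_rho refl]
  from assms show ?thesis
  proof (induction rule: borel_measurable_induct)
    case (cong f g)
    have "f = g" using cong(3) by (simp add: fun_eq_iff)
    then show ?case using cong(4) by (simp only:)
  next
    case (set A) then show ?case by (simp add: emeasure_rho)
  next
    case (mult f c) then show ?case by (simp add: nn_integral_cmult distrib_left)
  next
    case (add f g) then show ?case by (simp add: nn_integral_add ac_simps)
  next
    case (seq U)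
    have "(\<integral>\<^sup>+ y. (SUP i. U i) y \<partial>rho z) = (SUP i. \<integral>\<^sup>+ y. U i y \<partial>rho z)"
      using seq by (simp add: nn_integral_monotone_convergence_SUP image_comp)
    also have "\<dots> = (SUP i. U i z + (\<integral>\<^sup>+ y. U i y \<partial>lborel))"
      using seq by simp
    also have "\<dots> = (SUP i. U i z) + (SUP i. \<integral>\<^sup>+ y. U i y \<partial>lborel)"
      using seq by (intro ennreal_SUP_add) (auto simp: incseq_def le_fun_def intro!: nn_integral_mono)
    also have "(SUP i. \<integral>\<^sup>+ y. U i y \<partial>lborel) = (\<integral>\<^sup>+ y. (SUP i. U i) y \<partial>lborel)"
      using seq by (simp add: nn_integral_monotone_convergence_SUP image_comp)
    finally show ?case by (simp add: image_comp)
  qed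
qed

lemma sets_trans_kernel [simp, measurable_cong]: "sets (trans_kernel lam z t x) = sets borel"
  by (simp add: trans_kernel_def)

lemma space_trans_kernel [simp]: "space (trans_kernel lam z t x) = UNIV"
  by (simp add: trans_kernel_def)

lemma borel_measurable_q_fun [measurable]: "q_fun lam z t \<in> borel_measurable borel"
proof -
  have "mono Phi"
  proof -
    interpret prob_space std_normal_distribution by (rule prob_space_normal_density) simp
    show ?thesis unfolding Phi_def mono_def cdf_def by (auto intro!: finite_measure_mono)
  qed
  then have [measurable]: "Phi \<in> borel_measurable borel" by (rule borel_measurable_mono)
  show ?thesis unfolding q_fun_def[abs_def] by measurable
qed

lemma borel_measurable_normal_density2 [measurable (raw)]:
  assumes [measurable]: "f \<in> borel_measurable M" "g \<in> borel_measurable M"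
  shows "(\<lambda>x. normal_density (f x) s (g x)) \<in> borel_measurable M"
  unfolding normal_density_def by measurable

lemma nn_integral_trans_kernel_0: "f \<in> borel_measurable borel \<Longrightarrow> (\<integral>\<^sup>+ y. f y \<partial>trans_kernel lam z 0 x) = f x"
  by (simp add: trans_kernel_def nn_integral_return)

lemma nn_integral_trans_kernel_absorbed:
  assumes "t > 0" and [measurable]: "f \<in> borel_measurable borel"
  shows "(\<integral>\<^sup>+ y. f y \<partial>trans_kernel lam z t z) = f z"
proof -
  have [measurable]: "kernel_density lam z t z \<in> borel_measurable borel"
    unfolding kernel_density_def[abs_def] by simp
  have eq: "ennreal (kernel_density lam z t z y) * f y = f z * indicator {z} y" for y
    by (auto simp: kernel_density_def indicator_def)
  have "(\<integral>\<^sup>+ y. f y \<partial>trans_kernel lam z t z) = (\<integral>\<^sup>+ y. ennreal (kernel_density lam z t z y) * f y \<partial>rho z)"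
    using assms(1) by (simp add: trans_kernel_def nn_integral_density)
  also have "\<dots> = (\<integral>\<^sup>+ y. f z * indicator {z} y \<partial>rho z)"
    by (simp only: eq)
  also have "\<dots> = f z"
    by (subst nn_integral_rho) (auto simp: nn_integral_cmult)
  finally show ?thesis .
qed

text \<open>The atom of \<open>rho\<close> reads off \<open>q_fun\<close>. In the Lebesgue part the
  point \<open>z\<close> is negligible, so the cut-off at \<open>z\<close> disappears and the
  h-transformed Gaussian remains.\<close>

lemma nn_integral_trans_kernel:
  assumes "t > 0" "x \<noteq> z" and [measurable]: "f \<in> borel_measurable borel"
  shows "(\<integral>\<^sup>+ y. f y \<partial>trans_kernel lam z t x) = ennreal (q_fun lam z t x) * f z
    + (\<integral>\<^sup>+ y. ennreal (normal_density (x + lam * t) (sqrt t) y * hit_prob lam z y / hit_prob lam z x) * f y \<partial>lborel)"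
proof -
  have eq: "kernel_density lam z t x y = q_fun lam z t x * indicator {z} y
      + normal_density (x + lam * t) (sqrt t) y * hit_prob lam z y / hit_prob lam z x * indicator (-{z}) y" for y
    using assms(1,2) by (simp add: kernel_density_def gauss_p_eq hit_prob_def exp_minus divide_simps)
  have [measurable]: "kernel_density lam z t x \<in> borel_measurable borel"
    unfolding eq[abs_def] by measurable
  have "(\<integral>\<^sup>+ y. f y \<partial>trans_kernel lam z t x) = (\<integral>\<^sup>+ y. ennreal (kernel_density lam z t x y) * f y \<partial>rho z)"
    using assms(1) by (simp add: trans_kernel_def nn_integral_density)
  also have "\<dots> = ennreal (q_fun lam z t x) * f z + (\<integral>\<^sup>+ y. ennreal (kernel_density lam z t x y) * f y \<partial>lborel)"
    by (subst nn_integral_rho) (auto simp: eq)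
  also have "(\<integral>\<^sup>+ y. ennreal (kernel_density lam z t x y) * f y \<partial>lborel) =
      (\<integral>\<^sup>+ y. ennreal (normal_density (x + lam * t) (sqrt t) y * hit_prob lam z y / hit_prob lam z x) * f y \<partial>lborel)"
    by (rule nn_integral_cong_AE, use AE_lborel_singleton[of z] in eventually_elim) (auto simp: eq)
  finally show ?thesis .
qed

text \<open>Multiplication by \<open>hit_prob\<close> clears the denominator of the h-transform and
  leaves Gaussian integrals. As the factor is positive and finite, it can be cancelled
  afterwards.\<close>

lemma hit_prob_nn_integral_trans_kernel:
  assumes "t > 0" "x \<noteq> z" and [measurable]: "f \<in> borel_measurable borel"
  shows "ennreal (hit_prob lam z x) * (\<integral>\<^sup>+ y. f y \<partial>trans_kernel lam z t x)
    = ennreal (hit_prob lam z x * q_fun lam z t x) * f z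
    + (\<integral>\<^sup>+ y. ennreal (normal_density (x + lam * t) (sqrt t) y * hit_prob lam z y) * f y \<partial>lborel)"
  unfolding nn_integral_trans_kernel[OF assms]
  by (subst distrib_left, subst nn_integral_cmult[symmetric], measurable)
     (simp add: ennreal_mult' mult.assoc[symmetric] flip: ennreal_mult')

lemma prob_space_trans_kernel:
  assumes "t \<ge> 0" "lam \<ge> 0"
  shows "prob_space (trans_kernel lam z t x)"
proof
  show "emeasure (trans_kernel lam z t x) (space (trans_kernel lam z t x)) = 1"
  proof -
    have em: "emeasure (trans_kernel lam z t x) UNIV = (\<integral>\<^sup>+ y. 1 \<partial>trans_kernel lam z t x)" by simp
    consider "t = 0" | "t > 0" "x = z" | "t > 0" "x \<noteq> z" using assms by fastforce
    then have "emeasure (trans_kernel lam z t x) UNIV = 1"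
    proof cases
      case 1 then show ?thesis unfolding em by (subst 1, subst nn_integral_trans_kernel_0) auto
    next
      case 2 then show ?thesis unfolding em by (metis nn_integral_trans_kernel_absorbed measurable_const space_borel UNIV_I)
    next
      case 3
      note b = q_fun_bounds[OF 3(1) assms(2), of z x]
      \<comment> \<open>The atom carries \<open>hit_prob * q_fun\<close> and the Gaussian part
        \<open>hit_prob * (1 - q_fun)\<close>.\<close>
      have "ennreal (hit_prob lam z x) * (\<integral>\<^sup>+ y. 1 \<partial>trans_kernel lam z t x) = ennreal (hit_prob lam z x) * 1"
        using b ennreal_plus[of "hit_prob lam z x * q_fun lam z t x" "hit_prob lam z x * (1 - q_fun lam z t x)"]
        by (subst hit_prob_nn_integral_trans_kernel[OF 3])
           (simp_all add: nn_integral_normal_hit_prob[OF 3(1)] distrib_left[symmetric])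
      then show ?thesis unfolding em
        by (subst (asm) ennreal_mult_cancel_left) auto
    qed
    then show ?thesis by simp
  qed
qed

lemma measurable_nn_integral_trans_kernel:
  assumes "t \<ge> 0" and [measurable]: "f \<in> borel_measurable borel"
  shows "(\<lambda>x. \<integral>\<^sup>+ y. f y \<partial>trans_kernel lam z t x) \<in> borel_measurable borel"
proof (cases "t = 0")
  case True then show ?thesis by (simp add: nn_integral_trans_kernel_0)
next
  case False
  then have t: "t > 0" using assms by simp
  have "(\<lambda>x. \<integral>\<^sup>+ y. f y \<partial>trans_kernel lam z t x) = (\<lambda>x. if x = z then f z else ennreal (q_fun lam z t x) * f z
    + (\<integral>\<^sup>+ y. ennreal (normal_density (x + lam * t) (sqrt t) y * hit_prob lam z y / hit_prob lam z x) * f y \<partial>lborel))"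
    using t by (auto simp: fun_eq_iff nn_integral_trans_kernel nn_integral_trans_kernel_absorbed)
  also have "\<dots> \<in> borel_measurable borel" by measurable
  finally show ?thesis .
qed

lemma measurable_trans_kernel:
  assumes "t \<ge> 0" "lam \<ge> 0"
  shows "trans_kernel lam z t \<in> borel \<rightarrow>\<^sub>M prob_algebra borel"
proof (intro measurable_prob_algebraI measurable_subprob_algebra)
  fix A :: "real set" assume [measurable]: "A \<in> sets borel"
  then have "emeasure (trans_kernel lam z t x) A = (\<integral>\<^sup>+ y. indicator A y \<partial>trans_kernel lam z t x)" for x
    by simp
  then show "(\<lambda>x. emeasure (trans_kernel lam z t x) A) \<in> borel_measurable borel"
    using measurable_nn_integral_trans_kernel[OF assms(1), of "indicator A" lam z] by simp
qed (use prob_space_trans_kernel[OF assms] in \<open>auto simp: prob_space_imp_subprob_space\<close>)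

section \<open>The Chapman-Kolmogorov equation\<close>

lemma nn_integral_normal_density_conv:
  assumes "s > 0" "t > 0"
  shows "(\<integral>\<^sup>+ y. ennreal (normal_density (x + lam * s) (sqrt s) y * normal_density (y + lam * t) (sqrt t) w) \<partial>lborel)
       = ennreal (normal_density (x + lam * (s + t)) (sqrt (s + t)) w)"
proof -
  let ?f = "\<lambda>y. ennreal (normal_density (x + lam * s) (sqrt s) y * normal_density (y + lam * t) (sqrt t) w)"
  have "(\<integral>\<^sup>+ y. ?f y \<partial>lborel) = (\<integral>\<^sup>+ y. ?f (x + lam * s + y) \<partial>lborel)"
    using nn_integral_real_affine[of ?f 1 "x + lam * s"] by simp
  also have "\<dots> = (\<integral>\<^sup>+ y. ennreal (normal_density 0 (sqrt t) ((w - (x + lam * (s + t))) - y) * normal_density 0 (sqrt s) y) \<partial>lborel)"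
    by (intro nn_integral_cong arg_cong[where f=ennreal]) (simp add: normal_density_def algebra_simps)
  also have "\<dots> = ennreal (normal_density 0 (sqrt (s + t)) (w - (x + lam * (s + t))))"
    using conv_normal_density_zero_mean[of "sqrt t" "sqrt s", THEN fun_cong, of "w - (x + lam * (s + t))"] assms
    by (simp add: add.commute)
  finally show ?thesis by (simp add: normal_density_def)
qed

text \<open>On sets avoiding \<open>z\<close> the intermediate factors \<open>hit_prob\<close>
  cancel, and the claim is the convolution of two Gaussians. The atom at \<open>z\<close> would call
  for an identity between values of \<open>q_fun\<close>; this is bypassed, since both sides are
  probability measures and agree on the complement of \<open>z\<close>.\<close>

lemma chapman_kolmogorov:
  assumes "s \<ge> 0" "t \<ge> 0" "lam \<ge> 0" and A[measurable]: "A \<in> sets borel"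
  shows "emeasure (trans_kernel lam z (s + t) x) A = (\<integral>\<^sup>+ y. emeasure (trans_kernel lam z t y) A \<partial>trans_kernel lam z s x)"
proof -
  note [measurable] = measurable_trans_kernel[OF assms(1,3), of z] measurable_trans_kernel[OF assms(2,3), of z]
  have [measurable]: "(\<lambda>y. emeasure (trans_kernel lam z t y) A) \<in> borel_measurable borel" if "A \<in> sets borel" for A
    using measurable_nn_integral_trans_kernel[OF assms(2), of "indicator A" lam z] that by simp
  let ?R = "trans_kernel lam z s x \<bind> trans_kernel lam z t"
  have R: "emeasure ?R A = (\<integral>\<^sup>+ y. emeasure (trans_kernel lam z t y) A \<partial>trans_kernel lam z s x)"
    if "A \<in> sets borel" for A
    using that by (intro emeasure_bind[where N=borel]) (auto intro!: measurable_prob_algebraD simp: trans_kernel_def[of _ _ s])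
  consider "s = 0" | "t = 0" | "s > 0" "t > 0" "x = z" | "s > 0" "t > 0" "x \<noteq> z" using assms(1,2) by fastforce
  then show ?thesis
  proof cases
    case 1 then show ?thesis by (simp add: nn_integral_trans_kernel_0)
  next
    case 2 then show ?thesis by (simp add: trans_kernel_def[of _ _ 0] emeasure_return)
  next
    case 3
    have "emeasure (trans_kernel lam z u z) A = indicator A z" if "u > 0" for u
      using nn_integral_trans_kernel_absorbed[OF that, of "indicator A" lam z] by simp
    then show ?thesis using 3 by (simp add: nn_integral_trans_kernel_absorbed)
  next
    case 4
    let ?n = "\<lambda>x t. normal_density (x + lam * t) (sqrt t)" and ?h = "hit_prob lam z"
    have st: "s + t > 0" using 4 by simp
    have *: "emeasure (trans_kernel lam z (s + t) x) C = emeasure ?R C" if C: "C \<in> sets borel" "z \<notin> C" for C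
    proof -
      note [measurable] = C(1)
      have em: "ennreal (?h y) * emeasure (trans_kernel lam z u y) C = (\<integral>\<^sup>+ w. ennreal (?n y u w * ?h w) * indicator C w \<partial>lborel)"
        if "u > 0" "y \<noteq> z" for u y
        using hit_prob_nn_integral_trans_kernel[OF that, of "indicator C" lam] C by simp
      \<comment> \<open>Mass that has reached \<open>z\<close> never returns to \<open>C\<close>, so
        the atom of the first kernel contributes nothing.\<close>
      have em0: "emeasure (trans_kernel lam z t z) C = 0"
        using nn_integral_trans_kernel_absorbed[OF \<open>t > 0\<close>, of "indicator C" lam z] C by simp
      have "ennreal (?h x) * emeasure ?R C
         = (\<integral>\<^sup>+ y. ennreal (?n x s y * ?h y) * emeasure (trans_kernel lam z t y) C \<partial>lborel)"
        unfolding R[OF C(1)] using 4 em0 by (subst hit_prob_nn_integral_trans_kernel) auto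
      also have "\<dots> = (\<integral>\<^sup>+ y. ennreal (?n x s y) * (\<integral>\<^sup>+ w. ennreal (?n y t w * ?h w) * indicator C w \<partial>lborel) \<partial>lborel)"
        using em[OF \<open>t > 0\<close>]
        by (intro nn_integral_cong_AE, use AE_lborel_singleton[of z] in eventually_elim) (simp add: ennreal_mult' mult.assoc)
      also have "\<dots> = (\<integral>\<^sup>+ y. (\<integral>\<^sup>+ w. ennreal (?n x s y) * (ennreal (?n y t w * ?h w) * indicator C w) \<partial>lborel) \<partial>lborel)"
        by (intro nn_integral_cong nn_integral_cmult[symmetric]) simp
      also have "\<dots> = (\<integral>\<^sup>+ w. (\<integral>\<^sup>+ y. ennreal (?n x s y) * (ennreal (?n y t w * ?h w) * indicator C w) \<partial>lborel) \<partial>lborel)"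
        by (rule lborel_pair.Fubini') measurable
      also have "\<dots> = (\<integral>\<^sup>+ w. (\<integral>\<^sup>+ y. (ennreal (?h w) * indicator C w) * ennreal (?n x s y * ?n y t w) \<partial>lborel) \<partial>lborel)"
        by (intro nn_integral_cong) (simp add: ennreal_mult' ac_simps)
      also have "\<dots> = (\<integral>\<^sup>+ w. ennreal (?n x (s + t) w * ?h w) * indicator C w \<partial>lborel)"
        using 4 by (intro nn_integral_cong, subst nn_integral_cmult, measurable)
          (simp add: nn_integral_normal_density_conv, simp add: ennreal_mult' ac_simps)
      also have "\<dots> = ennreal (?h x) * emeasure (trans_kernel lam z (s + t) x) C"
        using em[OF st 4(3)] by simp
      finally show ?thesis by (subst (asm) ennreal_mult_cancel_left) auto
    qed
    interpret P: prob_space "trans_kernel lam z (s + t) x" using assms by (intro prob_space_trans_kernel) auto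
    have Ps: "trans_kernel lam z s x \<in> space (prob_algebra borel)"
      using assms by (simp add: space_prob_algebra prob_space_trans_kernel)
    interpret R: prob_space ?R
      using Ps measurable_trans_kernel[OF assms(2,3)] by (rule prob_space_bind')
    have sR: "sets ?R = sets borel"
      using Ps measurable_trans_kernel[OF assms(2,3)] by (rule sets_bind')
    have spR: "space ?R = UNIV" using sets_eq_imp_space_eq[OF sR] by simp
    have "P.prob (UNIV - (-{z})) = R.prob (UNIV - (-{z}))"
      using *[of "-{z}"] P.prob_compl[of "-{z}"] R.prob_compl[of "-{z}"]
      by (simp add: sR spR measure_def)
    then have z: "emeasure (trans_kernel lam z (s + t) x) {z} = emeasure ?R {z}"
      by (simp add: P.emeasure_eq_measure R.emeasure_eq_measure Compl_eq_Diff_UNIV[symmetric])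
    show ?thesis
    proof (cases "z \<in> A")
      case True
      have "emeasure N A = emeasure N {z} + emeasure N (A - {z})" if "sets N = sets borel" for N
        using True that by (subst plus_emeasure) (auto simp: insert_absorb)
      then show ?thesis using *[of "A - {z}"] z sR R[OF A] by simp
    qed (use * R[OF A] in auto)
  qed
qed

lemma transition_function_trans_kernel: "lam \<ge> 0 \<Longrightarrow> transition_function (trans_kernel lam z)"
  unfolding transition_function_def
  using measurable_trans_kernel chapman_kolmogorov by (auto simp: trans_kernel_def[of _ _ 0])

section \<open>Natural filtrations and continuous processes\<close>

lemma space_natural_filtration [simp]: "space (natural_filtration M X t) = space M"
  unfolding natural_filtration_def by (rule space_measure_of) auto

lemma sets_natural_filtration:
  "sets (natural_filtration M X t) =
     sigma_sets (space M) {X s -` A \<inter> space M |s A. 0 \<le> s \<and> ennreal s \<le> t \<and> A \<in> sets borel}"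
  unfolding natural_filtration_def by (rule sets_measure_of) auto

lemma measurable_natural_filtration:
  "0 \<le> s \<Longrightarrow> ennreal s \<le> t \<Longrightarrow> X s \<in> borel_measurable (natural_filtration M X t)"
  by (rule measurableI) (auto simp: sets_natural_filtration intro!: sigma_sets.Basic)

lemma sets_natural_filtration_mono:
  "s \<le> t \<Longrightarrow> sets (natural_filtration M X s) \<subseteq> sets (natural_filtration M X t)"
  unfolding sets_natural_filtration by (rule sigma_sets_mono') (auto intro: order_trans)

lemma filtration_natural_filtration: "filtration (space M) (natural_filtration M X)"
  by standard (auto dest: sets_natural_filtration_mono)

lemma subalgebra_natural_filtration:
  assumes "\<And>t. t \<ge> 0 \<Longrightarrow> X t \<in> borel_measurable M"
  shows "subalgebra M (natural_filtration M X t)"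
  unfolding subalgebra_def sets_natural_filtration
  by (auto intro!: sets.sigma_sets_subset measurable_sets[OF assms])

text \<open>The value \<open>z\<close> is attained on \<open>[a, b]\<close> iff \<open>\<bar>Y - z\<bar>\<close> has infimum \<open>0\<close> over a countable dense set.\<close>

lemma sets_attains_on_interval:
  fixes Y :: "real \<Rightarrow> 'a \<Rightarrow> real"
  assumes cont: "\<And>\<omega>. \<omega> \<in> space M \<Longrightarrow> continuous_on {a..b} (\<lambda>t. Y t \<omega>)"
    and meas: "\<And>t. t \<in> {a..b} \<Longrightarrow> Y t \<in> borel_measurable M"
  shows "{\<omega>\<in>space M. \<exists>t\<in>{a..b}. Y t \<omega> = z} \<in> sets M"
proof (cases "a \<le> b")
  case True
  \<comment> \<open>The endpoints are included because a degenerate interval may contain no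
    rational; any other point is approximated by rationals from the left.\<close>
  define D where "D = {a, b} \<union> ({a..b} \<inter> \<rat>)"
  have D: "countable D" "D \<subseteq> {a..b}" using True by (auto simp: D_def countable_rat)
  have "{\<omega>\<in>space M. \<exists>t\<in>{a..b}. Y t \<omega> = z} = (\<Inter>n::nat. \<Union>q\<in>D. {\<omega>\<in>space M. \<bar>Y q \<omega> - z\<bar> < 1 / Suc n})"
  proof (intro equalityI subsetI)
    fix \<omega> assume "\<omega> \<in> {\<omega>\<in>space M. \<exists>t\<in>{a..b}. Y t \<omega> = z}"
    then obtain t where t: "\<omega> \<in> space M" "t \<in> {a..b}" "Y t \<omega> = z" by auto
    have "\<exists>q\<in>D. \<bar>Y q \<omega> - z\<bar> < e" if "e > 0" for e
    proof (cases "t \<in> {a, b}")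
      case False
      from cont[OF t(1)] t(2) \<open>e > 0\<close> obtain d where d: "d > 0"
          "\<And>s. s \<in> {a..b} \<Longrightarrow> \<bar>s - t\<bar> < d \<Longrightarrow> \<bar>Y s \<omega> - Y t \<omega>\<bar> < e"
        unfolding continuous_on_iff dist_real_def by metis
      have "max a (t - d) < t" using False t d by auto
      then obtain q where q: "q \<in> \<rat>" "max a (t - d) < q" "q < t" using Rats_dense_in_real by blast
      then have "q \<in> D" "\<bar>q - t\<bar> < d" using t by (auto simp: D_def)
      with d(2)[of q] D(2) t show ?thesis by (intro bexI[of _ q]) auto
    qed (use t that in \<open>auto simp: D_def\<close>)
    with t show "\<omega> \<in> (\<Inter>n::nat. \<Union>q\<in>D. {\<omega>\<in>space M. \<bar>Y q \<omega> - z\<bar> < 1 / Suc n})" by auto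
  next
    fix \<omega> assume *: "\<omega> \<in> (\<Inter>n::nat. \<Union>q\<in>D. {\<omega>\<in>space M. \<bar>Y q \<omega> - z\<bar> < 1 / Suc n})"
    then have \<omega>: "\<omega> \<in> space M" by auto
    have "continuous_on {a..b} (\<lambda>t. \<bar>Y t \<omega> - z\<bar>)"
      by (intro continuous_intros cont \<omega>)
    then obtain t where t: "t \<in> {a..b}" "\<And>s. s \<in> {a..b} \<Longrightarrow> \<bar>Y t \<omega> - z\<bar> \<le> \<bar>Y s \<omega> - z\<bar>"
      using continuous_attains_inf[of "{a..b}" "\<lambda>t. \<bar>Y t \<omega> - z\<bar>"] True by auto
    have "\<bar>Y t \<omega> - z\<bar> < 1 / Suc n" for n
    proof -
      from * obtain q where "q \<in> D" "\<bar>Y q \<omega> - z\<bar> < 1 / Suc n" by auto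
      with t(2)[of q] D(2) show ?thesis by auto
    qed
    then have "\<bar>Y t \<omega> - z\<bar> \<le> 0"
      by (metis not_le nat_approx_posE less_asym)
    with \<omega> t show "\<omega> \<in> {\<omega>\<in>space M. \<exists>t\<in>{a..b}. Y t \<omega> = z}" by auto
  qed
  moreover have *: "{\<omega>\<in>space M. \<bar>Y q \<omega> - z\<bar> < 1 / Suc n} \<in> sets M" if "q \<in> D" for q and n :: nat
    using meas[of q] D that by (auto intro!: borel_measurable_less borel_measurable_abs)
  from * have "(\<Union>q\<in>D. {\<omega>\<in>space M. \<bar>Y q \<omega> - z\<bar> < 1 / Suc n}) \<in> sets M" for n :: nat
    using D(1) by (intro sets.countable_UN'')
  ultimately show ?thesis
    by (simp only:) (rule sets.countable_INT, auto)
next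
  case False
  then have "{\<omega>\<in>space M. \<exists>t\<in>{a..b}. Y t \<omega> = z} = {}" by auto
  then show ?thesis by (metis sets.empty_sets)
qed

text \<open>Rounding \<open>R\<close> down to multiples of \<open>1 / Suc n\<close> gives times with
  countably many values, and continuity of the paths passes to the limit.\<close>

lemma borel_measurable_random_time:
  fixes Y :: "real \<Rightarrow> 'a \<Rightarrow> real"
  assumes cont: "\<And>\<omega>. \<omega> \<in> space M \<Longrightarrow> continuous_on {0..} (\<lambda>t. Y t \<omega>)"
    and meas: "\<And>t. t \<ge> 0 \<Longrightarrow> Y t \<in> borel_measurable M"
    and R[measurable]: "R \<in> borel_measurable M" and pos: "\<And>\<omega>. \<omega> \<in> space M \<Longrightarrow> R \<omega> \<ge> 0"
  shows "(\<lambda>\<omega>. Y (R \<omega>) \<omega>) \<in> borel_measurable M"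
proof (rule borel_measurable_LIMSEQ_real)
  let ?r = "\<lambda>n \<omega>. real (nat \<lfloor>real (Suc n) * R \<omega>\<rfloor>) / real (Suc n)"
  fix \<omega> assume \<omega>: "\<omega> \<in> space M"
  have "(\<lambda>n. ?r n \<omega>) \<longlonglongrightarrow> R \<omega>"
  proof (rule tendsto_sandwich)
    show "eventually (\<lambda>n. R \<omega> - 1 / Suc n \<le> ?r n \<omega>) sequentially"
    proof (rule always_eventually, rule allI)
      fix n show "R \<omega> - 1 / Suc n \<le> ?r n \<omega>"
        using pos[OF \<omega>] divide_right_mono[OF real_of_int_floor_ge_diff_one[of "real (Suc n) * R \<omega>"], of "real (Suc n)"]
        by (simp add: diff_divide_distrib)
    qed
    show "eventually (\<lambda>n. ?r n \<omega> \<le> R \<omega>) sequentially"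
    proof (rule always_eventually, rule allI)
      fix n show "?r n \<omega> \<le> R \<omega>"
        using pos[OF \<omega>] of_int_floor_le[of "real (Suc n) * R \<omega>"] by (simp add: field_simps)
    qed
    show "(\<lambda>n. R \<omega> - 1 / Suc n) \<longlonglongrightarrow> R \<omega>"
      using tendsto_diff[OF tendsto_const LIMSEQ_inverse_real_of_nat] by (simp add: inverse_eq_divide)
  qed auto
  then show "(\<lambda>n. Y (?r n \<omega>) \<omega>) \<longlonglongrightarrow> Y (R \<omega>) \<omega>"
    using continuous_on_tendsto_compose[OF cont[OF \<omega>], of "\<lambda>n. ?r n \<omega>" "R \<omega>"] pos[OF \<omega>] by simp
next
  fix n
  show "(\<lambda>\<omega>. Y (real (nat \<lfloor>real (Suc n) * R \<omega>\<rfloor>) / real (Suc n)) \<omega>) \<in> borel_measurable M"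
    by (rule measurable_compose_countable[where f="\<lambda>k. Y (real k / real (Suc n))"
        and g="\<lambda>\<omega>. nat \<lfloor>real (Suc n) * R \<omega>\<rfloor>"]) (auto intro: meas)
qed

lemma strict_sorted_nth_sorted_list_of_set:
  fixes S :: "real set"
  assumes "i < j" "j < card S"
  shows "sorted_list_of_set S ! i < sorted_list_of_set S ! j"
  using assms strict_sorted_list_of_set[of S] by (auto simp: sorted_wrt_iff_nth_less)

section \<open>Independence of increments\<close>

locale drifted_bm = prob_space M for M :: "'a measure" +
  fixes B :: "real \<Rightarrow> 'a \<Rightarrow> real" and lam z :: real
  assumes bm: "brownian_motion M B" and lam_pos: "lam > 0" and z_pos: "z > 0"
begin

abbreviation "X \<equiv> drifted B lam"
abbreviation "F u \<equiv> natural_filtration M X (ennreal u)"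

lemma measurable_B: "t \<ge> 0 \<Longrightarrow> B t \<in> borel_measurable M"
  using bm by (auto simp: brownian_motion_def)

lemma measurable_X [measurable]: "t \<ge> 0 \<Longrightarrow> X t \<in> borel_measurable M"
  using measurable_B unfolding drifted_def[abs_def] by (auto intro!: borel_measurable_add)

lemma continuous_X: "\<omega> \<in> space M \<Longrightarrow> continuous_on {0..} (\<lambda>t. X t \<omega>)"
  using bm unfolding drifted_def by (auto simp: brownian_motion_def intro!: continuous_intros)

lemma AE_X_0: "AE \<omega> in M. X 0 \<omega> = 0"
  using bm by (simp add: drifted_def brownian_motion_def)

lemma subalgebra_F: "subalgebra M (F u)"
  by (rule subalgebra_natural_filtration) simp

lemma sets_F_events: "A \<in> sets (F u) \<Longrightarrow> A \<in> events"
  using subalgebra_F by (auto simp: subalgebra_def)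

lemma measurable_X_F: "0 \<le> s \<Longrightarrow> s \<le> t \<Longrightarrow> X s \<in> borel_measurable (F t)"
  by (intro measurable_natural_filtration ennreal_leI)

lemma sets_F_mono: "s \<le> t \<Longrightarrow> A \<in> sets (F s) \<Longrightarrow> A \<in> sets (F t)"
  using sets_natural_filtration_mono[OF ennreal_leI] by blast

lemma distributed_increment:
  assumes "0 \<le> s" "s < t"
  shows "distributed M lborel (\<lambda>\<omega>. X t \<omega> - X s \<omega>) (normal_density (lam * (t - s)) (sqrt (t - s)))"
proof -
  have "distributed M lborel (\<lambda>\<omega>. B t \<omega> - B s \<omega>) (normal_density 0 (sqrt (t - s)))"
    using bm assms by (auto simp: brownian_motion_def)
  from normal_density_affine[OF this, of 1 "lam * (t - s)"] show ?thesis
    using assms by (simp add: drifted_def algebra_simps)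
qed

text \<open>As \<open>B\<^sub>0 = 0\<close> almost surely, the values at finitely many times are, up to a null set, functions of the
  increments over a partition of \<open>[0, s]\<close>.\<close>

lemma prob_past_increment:
  assumes st: "0 \<le> s" "s < t" and J: "finite J" "J \<subseteq> {0..s}"
    and C: "\<And>u. C u \<in> sets borel" and D: "D \<in> sets borel"
  shows "prob ({\<omega>\<in>space M. \<forall>u\<in>J. X u \<omega> \<in> C u} \<inter> ((\<lambda>\<omega>. X t \<omega> - X s \<omega>) -` D \<inter> space M))
       = prob {\<omega>\<in>space M. \<forall>u\<in>J. X u \<omega> \<in> C u} * prob ((\<lambda>\<omega>. X t \<omega> - X s \<omega>) -` D \<inter> space M)"
proof -
  \<comment> \<open>With 0 in the grid every value is a sum of increments from the start; with
    \<open>s\<close> as the last point of \<open>S\<close> and \<open>t\<close> appended,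
    \<open>Y n\<close> is exactly the increment from \<open>s\<close> to \<open>t\<close>, while
    \<open>Y i\<close> for \<open>i < n\<close> describes the past.\<close>
  define S where "S = insert 0 (insert s J)"
  define L where "L = sorted_list_of_set S"
  define n where "n = card S - 1"
  define r where "r i = (if i \<le> n then L ! i else t)" for i
  define Y where "Y i \<omega> = B (r (Suc i)) \<omega> - B (r i) \<omega>" for i \<omega>
  have S: "finite S" "S \<subseteq> {0..s}" "card S > 0" using J st by (auto simp: S_def card_gt_0_iff)
  have L: "set L = S" "length L = Suc n" using S by (auto simp: L_def n_def)
  have less: "L ! i < L ! j" if "i < j" "j \<le> n" for i j
    using that S strict_sorted_nth_sorted_list_of_set[of i j S] by (auto simp: L_def n_def)
  have LS: "L ! i \<in> S" if "i \<le> n" for i using L that nth_mem[of i L] by auto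
  have ex: "\<exists>k\<le>n. L ! k = u" if "u \<in> S" for u
    using that L unfolding L(1)[symmetric] in_set_conv_nth by (auto simp: less_Suc_eq_le)
  have L0: "L ! 0 = 0"
  proof -
    obtain k where k: "k \<le> n" "L ! k = 0" using ex[of 0] by (auto simp: S_def)
    have "k = 0" using less[of 0 k] k LS[of 0] S(2) by (cases "k = 0") auto
    with k show ?thesis by simp
  qed
  have Ln: "L ! n = s"
  proof -
    obtain k where k: "k \<le> n" "L ! k = s" using ex[of s] by (auto simp: S_def)
    have "k = n" using less[of k n] k LS[of n] S(2) by (cases "k = n") auto
    with k show ?thesis by simp
  qed
  have r: "0 \<le> r 0" "\<forall>i<Suc n. r i < r (Suc i)"
    using L0 Ln st by (auto simp: r_def less less_Suc_eq)
  have ind: "indep_vars (\<lambda>_. borel) Y {..<Suc n}"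
    using bm r unfolding brownian_motion_def Y_def by auto
  have iv: "indep_var (PiM {..<n} (\<lambda>_. borel)) (\<lambda>\<omega>. restrict (\<lambda>i. Y i \<omega>) {..<n})
              (PiM {n} (\<lambda>_. borel)) (\<lambda>\<omega>. restrict (\<lambda>i. Y i \<omega>) {n})"
    by (rule indep_var_restrict[OF ind]) auto
  obtain k where k: "\<And>u. u \<in> J \<Longrightarrow> k u \<le> n \<and> L ! k u = u"
    using ex unfolding S_def by (metis insertCI)
  have B: "B u \<omega> = B 0 \<omega> + (\<Sum>i<k u. Y i \<omega>)" if "u \<in> J" for u \<omega>
    using k[OF that] L0 sum_lessThan_telescope[of "\<lambda>i. B (r i) \<omega>" "k u"] by (simp add: Y_def r_def)
  define E where "E = {f\<in>space (PiM {..<n} (\<lambda>_. borel :: real measure)). \<forall>u\<in>J. (\<Sum>i<k u. f i) + lam * u \<in> C u}"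
  define E' where "E' = {f\<in>space (PiM {n} (\<lambda>_. borel :: real measure)). f n + lam * (t - s) \<in> D}"
  have E: "E \<in> sets (PiM {..<n} (\<lambda>_. borel))"
  proof -
    have "{f\<in>space (PiM {..<n} (\<lambda>_. borel :: real measure)). (\<Sum>i<k u. f i) + lam * u \<in> C u} \<in> sets (PiM {..<n} (\<lambda>_. borel))"
      if "u \<in> J" for u
    proof -
      have "(\<lambda>f. (\<Sum>i<k u. f i) + lam * u) \<in> borel_measurable (PiM {..<n} (\<lambda>_. borel :: real measure))"
        using k[OF that] by (intro borel_measurable_add borel_measurable_sum measurable_component_singleton) auto
      from measurable_sets_Collect[OF this, of "\<lambda>x. x \<in> C u"] C show ?thesis by simp
    qed
    then show ?thesis unfolding E_def using J by (intro sets.sets_Collect_finite_All) auto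
  qed
  have E': "E' \<in> sets (PiM {n} (\<lambda>_. borel))"
  proof -
    have "(\<lambda>f. f n + lam * (t - s)) \<in> borel_measurable (PiM {n} (\<lambda>_. borel :: real measure))"
      by (intro borel_measurable_add measurable_component_singleton) auto
    from measurable_sets_Collect[OF this, of "\<lambda>x. x \<in> D"] D show ?thesis unfolding E'_def by simp
  qed
  let ?a = "{\<omega>\<in>space M. \<forall>u\<in>J. X u \<omega> \<in> C u}" and ?b = "(\<lambda>\<omega>. X t \<omega> - X s \<omega>) -` D \<inter> space M"
  let ?a' = "(\<lambda>\<omega>. restrict (\<lambda>i. Y i \<omega>) {..<n}) -` E \<inter> space M"
  let ?b' = "(\<lambda>\<omega>. restrict (\<lambda>i. Y i \<omega>) {n}) -` E' \<inter> space M"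
  have a: "AE \<omega> in M. \<omega> \<in> ?a \<longleftrightarrow> \<omega> \<in> ?a'"
    using AE_X_0
  proof eventually_elim
    case (elim \<omega>)
    have "X u \<omega> = (\<Sum>i<k u. restrict (\<lambda>i. Y i \<omega>) {..<n} i) + lam * u" if "u \<in> J" for u
      using B[OF that, of \<omega>] elim k[OF that] by (auto simp: drifted_def intro!: sum.cong)
    then show ?case by (auto simp: E_def space_PiM)
  qed
  have b: "?b = ?b'"
    using Ln by (auto simp: E'_def space_PiM Y_def r_def drifted_def algebra_simps)
  have [measurable]: "?a \<in> events" "?b \<in> events" "?a' \<in> events"
  proof -
    have "{\<omega>\<in>space M. X u \<omega> \<in> C u} \<in> events" if "u \<in> J" for u
      using measurable_sets_Collect[OF measurable_X, of u "\<lambda>x. x \<in> C u"] C J that by auto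
    then show "?a \<in> events" using J by (intro sets.sets_Collect_finite_All) auto
    show "?b \<in> events" using st D by (intro measurable_sets[of _ _ borel] borel_measurable_diff measurable_X) auto
    show "?a' \<in> events" using indep_var_rv1[OF iv] E by (rule measurable_sets)
  qed
  have "prob (?a \<inter> ?b) = prob (?a' \<inter> ?b)"
    by (rule finite_measure_eq_AE, use a in eventually_elim) auto
  also have "?a' \<inter> ?b = (\<lambda>\<omega>. (restrict (\<lambda>i. Y i \<omega>) {..<n}, restrict (\<lambda>i. Y i \<omega>) {n})) -` (E \<times> E') \<inter> space M"
    unfolding b by auto
  also have "prob \<dots> = prob ?a' * prob ?b"
    unfolding b by (rule indep_varD[OF iv E E'])
  also have "prob ?a' = prob ?a"
    by (rule finite_measure_eq_AE, use a in eventually_elim) auto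
  finally show ?thesis .
qed

text \<open>The finite-dimensional cylinders form a generator of the past that is stable under
  intersections, so the product formula extends from them to the generated sigma-algebra.\<close>

lemma indep_past_increment:
  assumes st: "0 \<le> s" "s < t"
  shows "indep_set (sets (F s)) (sigma_sets (space M) {(\<lambda>\<omega>. X t \<omega> - X s \<omega>) -` D \<inter> space M |D. D \<in> sets borel})"
proof -
  define P where "P = {{\<omega>\<in>space M. \<forall>u\<in>J. X u \<omega> \<in> C u} |J C. finite J \<and> J \<subseteq> {0..s} \<and> (\<forall>u. C u \<in> sets borel)}"
  have PE: "\<exists>J C. A = {\<omega>\<in>space M. \<forall>u\<in>J. X u \<omega> \<in> C u} \<and> finite J \<and> J \<subseteq> {0..s} \<and> (\<forall>u. C u \<in> sets borel)"
    if "A \<in> P" for A using that by (auto simp: P_def)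
  have Pev: "P \<subseteq> sets (F s)"
  proof
    fix A assume "A \<in> P"
    then obtain J C where A: "A = {\<omega>\<in>space M. \<forall>u\<in>J. X u \<omega> \<in> C u}" and J: "finite J" "J \<subseteq> {0..s}"
      and C: "\<forall>u. C u \<in> sets borel"
      using PE[OF \<open>A \<in> P\<close>] by (elim exE conjE) (rule that)
    have "{\<omega>\<in>space (F s). X u \<omega> \<in> C u} \<in> sets (F s)" if "u \<in> J" for u
      using measurable_sets_Collect[OF measurable_X_F[of u s], of "\<lambda>x. x \<in> C u"] C J that by auto
    then have "{\<omega>\<in>space (F s). \<forall>u\<in>J. X u \<omega> \<in> C u} \<in> sets (F s)"
      using J by (intro sets.sets_Collect_finite_All) auto
    then show "A \<in> sets (F s)" by (simp add: A)
  qed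
  have "Int_stable P"
  proof (rule Int_stableI)
    fix A A' assume "A \<in> P" "A' \<in> P"
    then obtain J C J' C' where A: "A = {\<omega>\<in>space M. \<forall>u\<in>J. X u \<omega> \<in> C u}" "finite J" "J \<subseteq> {0..s}" "\<forall>u. C u \<in> sets borel"
      and A': "A' = {\<omega>\<in>space M. \<forall>u\<in>J'. X u \<omega> \<in> C' u}" "finite J'" "J' \<subseteq> {0..s}" "\<forall>u. C' u \<in> sets borel"
      using PE[OF \<open>A \<in> P\<close>] PE[OF \<open>A' \<in> P\<close>] by (elim exE conjE) (rule that)
    let ?C = "\<lambda>u. (if u \<in> J then C u else UNIV) \<inter> (if u \<in> J' then C' u else UNIV)"
    have "A \<inter> A' = {\<omega>\<in>space M. \<forall>u\<in>J \<union> J'. X u \<omega> \<in> ?C u}" by (auto simp: A(1) A'(1))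
    moreover have "\<forall>u. ?C u \<in> sets borel" using A(4) A'(4) by auto
    ultimately show "A \<inter> A' \<in> P" unfolding P_def using A(2,3) A'(2,3)
      by (intro CollectI exI[of _ "J \<union> J'"] exI[of _ ?C]) auto
  qed
  have eq: "sigma_sets (space M) P = sets (F s)"
  proof
    show "sigma_sets (space M) P \<subseteq> sets (F s)"
      using sets.sigma_sets_subset[OF Pev] by simp
    show "sets (F s) \<subseteq> sigma_sets (space M) P"
      unfolding sets_natural_filtration
    proof (rule sigma_sets_mono', clarify)
      fix u A assume u: "0 \<le> u" "ennreal u \<le> ennreal s" and A: "A \<in> sets (borel :: real measure)"
      then have "u \<le> s" using st by simp
      with u A show "X u -` A \<inter> space M \<in> P" unfolding P_def
        by (intro CollectI exI[of _ "{u}"] exI[of _ "\<lambda>_. A"]) auto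
    qed
  qed
  have "indep_set (sigma_sets (space M) P)
      (sigma_sets (space M) {(\<lambda>\<omega>. X t \<omega> - X s \<omega>) -` D \<inter> space M |D. D \<in> sets borel})"
  proof (rule indep_set_sigma_sets[OF indep_setI])
    show "P \<subseteq> events" using Pev sets_F_events by auto
    show "{(\<lambda>\<omega>. X t \<omega> - X s \<omega>) -` D \<inter> space M |D. D \<in> sets borel} \<subseteq> events"
      using st by (auto intro!: measurable_sets[of _ _ borel] borel_measurable_diff measurable_X)
    show "Int_stable {(\<lambda>\<omega>. X t \<omega> - X s \<omega>) -` D \<inter> space M |D. D \<in> sets borel}"
    proof (rule Int_stableI, clarify)
      fix D D' :: "real set" assume "D \<in> sets borel" "D' \<in> sets borel"
      then show "\<exists>D''. (\<lambda>\<omega>. X t \<omega> - X s \<omega>) -` D \<inter> space M \<inter> ((\<lambda>\<omega>. X t \<omega> - X s \<omega>) -` D' \<inter> space M)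
         = (\<lambda>\<omega>. X t \<omega> - X s \<omega>) -` D'' \<inter> space M \<and> D'' \<in> sets borel"
        by (intro exI[of _ "D \<inter> D'"]) auto
    qed
    fix a b assume "a \<in> P" "b \<in> {(\<lambda>\<omega>. X t \<omega> - X s \<omega>) -` D \<inter> space M |D. D \<in> sets borel}"
    then show "prob (a \<inter> b) = prob a * prob b"
      using prob_past_increment[OF st] by (auto simp: P_def)
  qed fact
  then show ?thesis by (simp add: eq)
qed

text \<open>Independence makes the joint law of \<open>Y\<close> and the increment a product, and
  Tonelli integrates out the increment. The general target space \<open>N\<close> lets
  \<open>Y\<close> carry a weight together with the current state.\<close>

lemma nn_integral_past_increment:
  assumes st: "0 \<le> s" "s < t" and Y: "Y \<in> F s \<rightarrow>\<^sub>M N" and g[measurable]: "g \<in> borel_measurable (N \<Otimes>\<^sub>M borel)"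
  shows "(\<integral>\<^sup>+ \<omega>. g (Y \<omega>, X t \<omega> - X s \<omega>) \<partial>M)
     = (\<integral>\<^sup>+ \<omega>. (\<integral>\<^sup>+ r. ennreal (normal_density (lam * (t - s)) (sqrt (t - s)) r) * g (Y \<omega>, r) \<partial>lborel) \<partial>M)"
proof -
  let ?D = "\<lambda>\<omega>. X t \<omega> - X s \<omega>"
  note [measurable] = measurable_from_subalg[OF subalgebra_F Y]
  have [measurable]: "?D \<in> borel_measurable M" using st by simp
  have "indep_set (sigma_sets (space M) {Y -` A \<inter> space M |A. A \<in> sets N})
      (sigma_sets (space M) {?D -` A \<inter> space M |A. A \<in> sets borel})"
  proof -
    have "{Y -` A \<inter> space M |A. A \<in> sets N} \<subseteq> sets (F s)"
      using measurable_sets[OF Y] by auto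
    from sets.sigma_sets_subset[OF this]
    have "sigma_sets (space M) {Y -` A \<inter> space M |A. A \<in> sets N} \<subseteq> sets (F s)" by simp
    with indep_past_increment[OF st] show ?thesis
      unfolding indep_sets2_eq by blast
  qed
  then have ind: "prob ((Y -` A \<inter> space M) \<inter> (?D -` C \<inter> space M)) = prob (Y -` A \<inter> space M) * prob (?D -` C \<inter> space M)"
    if "A \<in> sets N" "C \<in> sets borel" for A C
    using that by (intro indep_setD) (auto intro: sigma_sets.Basic)
  interpret D: prob_space "distr M borel ?D" by (rule prob_space_distr) simp
  interpret Y: prob_space "distr M N Y" by (rule prob_space_distr) simp
  have joint: "distr M N Y \<Otimes>\<^sub>M distr M borel ?D = distr M (N \<Otimes>\<^sub>M borel) (\<lambda>\<omega>. (Y \<omega>, ?D \<omega>))"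
  proof (rule pair_measure_eqI)
    fix A C assume "A \<in> sets (distr M N Y)" "C \<in> sets (distr M borel ?D)"
    then have [measurable]: "A \<in> sets N" "C \<in> sets borel" by auto
    have "(\<lambda>\<omega>. (Y \<omega>, ?D \<omega>)) -` (A \<times> C) \<inter> space M = (Y -` A \<inter> space M) \<inter> (?D -` C \<inter> space M)" by auto
    then show "emeasure (distr M N Y) A * emeasure (distr M borel ?D) C
        = emeasure (distr M (N \<Otimes>\<^sub>M borel) (\<lambda>\<omega>. (Y \<omega>, ?D \<omega>))) (A \<times> C)"
      using ind[of A C] by (simp add: emeasure_distr emeasure_eq_measure ennreal_mult')
  qed (auto intro: D.sigma_finite_measure_axioms Y.sigma_finite_measure_axioms)
  have "(\<integral>\<^sup>+ \<omega>. g (Y \<omega>, ?D \<omega>) \<partial>M) = (\<integral>\<^sup>+ p. g p \<partial>distr M (N \<Otimes>\<^sub>M borel) (\<lambda>\<omega>. (Y \<omega>, ?D \<omega>)))"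
    by (subst nn_integral_distr) auto
  also have "\<dots> = (\<integral>\<^sup>+ p. g p \<partial>(distr M N Y \<Otimes>\<^sub>M distr M borel ?D))"
    by (simp only: joint)
  also have "\<dots> = (\<integral>\<^sup>+ y. (\<integral>\<^sup>+ r. g (y, r) \<partial>distr M borel ?D) \<partial>distr M N Y)"
    by (rule D.nn_integral_fst[symmetric]) simp
  also have "\<dots> = (\<integral>\<^sup>+ \<omega>. (\<integral>\<^sup>+ r. g (Y \<omega>, r) \<partial>distr M borel ?D) \<partial>M)"
    by (rule nn_integral_distr) (auto intro!: D.borel_measurable_nn_integral_fst)
  also have "\<dots> = (\<integral>\<^sup>+ \<omega>. (\<integral>\<^sup>+ r. ennreal (normal_density (lam * (t - s)) (sqrt (t - s)) r) * g (Y \<omega>, r) \<partial>lborel) \<partial>M)"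
  proof (rule nn_integral_cong)
    fix \<omega> assume \<omega>: "\<omega> \<in> space M"
    have [measurable]: "Y \<omega> \<in> space N" using \<omega> by (rule measurable_space[rotated]) simp
    have "distr M borel ?D = density lborel (normal_density (lam * (t - s)) (sqrt (t - s)))"
      using distributed_distr_eq_density[OF distributed_increment[OF st]] by (simp cong: distr_cong)
    then show "(\<integral>\<^sup>+ r. g (Y \<omega>, r) \<partial>distr M borel ?D) = (\<integral>\<^sup>+ r. ennreal (normal_density (lam * (t - s)) (sqrt (t - s)) r) * g (Y \<omega>, r) \<partial>lborel)"
      by (simp add: nn_integral_density)
  qed
  finally show ?thesis .
qed

end

section \<open>The hitting probability\<close>

text \<open>Completing the square: the exponential shifts the mean by
  \<open>a * \<sigma>\<^sup>2\<close>, and the constant left over is the moment generating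
  function.\<close>

lemma nn_integral_normal_exp:
  assumes "\<sigma> > 0"
  shows "(\<integral>\<^sup>+ r. ennreal (normal_density \<mu> \<sigma> r) * ennreal (exp (a * r)) \<partial>lborel) = ennreal (exp (a * \<mu> + a\<^sup>2 * \<sigma>\<^sup>2 / 2))"
proof -
  have "normal_density \<mu> \<sigma> r * exp (a * r) = exp (a * \<mu> + a\<^sup>2 * \<sigma>\<^sup>2 / 2) * normal_density (\<mu> + a * \<sigma>\<^sup>2) \<sigma> r" for r
  proof -
    have "- (r - \<mu>)\<^sup>2 / (2 * \<sigma>\<^sup>2) + a * r = (a * \<mu> + a\<^sup>2 * \<sigma>\<^sup>2 / 2) - (r - (\<mu> + a * \<sigma>\<^sup>2))\<^sup>2 / (2 * \<sigma>\<^sup>2)"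
      using assms by (simp add: field_simps power2_eq_square)
    then show ?thesis by (simp add: normal_density_def flip: exp_add)
  qed
  then have "(\<integral>\<^sup>+ r. ennreal (normal_density \<mu> \<sigma> r) * ennreal (exp (a * r)) \<partial>lborel)
     = (\<integral>\<^sup>+ r. ennreal (exp (a * \<mu> + a\<^sup>2 * \<sigma>\<^sup>2 / 2)) * ennreal (normal_density (\<mu> + a * \<sigma>\<^sup>2) \<sigma> r) \<partial>lborel)"
    by (simp flip: ennreal_mult')
  also have "\<dots> = ennreal (exp (a * \<mu> + a\<^sup>2 * \<sigma>\<^sup>2 / 2))"
    using assms by (simp add: nn_integral_cmult)
  finally show ?thesis .
qed

text \<open>The sequence \<open>x\<close> stopped at its first entrance into \<open>(-\<infinity>, c]\<close>.\<close>

primrec stop_below :: "real \<Rightarrow> (nat \<Rightarrow> real) \<Rightarrow> nat \<Rightarrow> real" where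
  "stop_below c x 0 = x 0"
| "stop_below c x (Suc k) = (if \<forall>j\<le>k. x j > c then x (Suc k) else stop_below c x k)"

lemma stop_below_eq: "\<forall>j<k. x j > c \<Longrightarrow> stop_below c x k = x k"
  by (cases k) auto

lemma stop_below_le: "x j \<le> c \<Longrightarrow> j \<le> k \<Longrightarrow> stop_below c x k \<le> c"
proof (induction k arbitrary: j)
  case (Suc k)
  show ?case
  proof (cases "\<forall>i\<le>k. x i > c")
    case True
    then have "j = Suc k" using Suc.prems by (metis le_Suc_eq not_le)
    then show ?thesis using True Suc.prems by simp
  next
    case False
    then obtain i where "i \<le> k" "x i \<le> c" by (auto simp: not_less)
    then show ?thesis using False Suc.IH[of i] by auto
  qed
qed auto

text \<open>The step that enters the lower ray starts above \<open>c\<close>, so it ends at most one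
  step size below \<open>c\<close>.\<close>

lemma stop_below_ge:
  assumes "x 0 > c" "\<eta> \<ge> 0" "\<And>i. i < k \<Longrightarrow> \<bar>x (Suc i) - x i\<bar> \<le> \<eta>"
  shows "stop_below c x k \<ge> c - \<eta>"
  using assms(3)
proof (induction k)
  case (Suc k)
  have "x (Suc k) \<ge> c - \<eta>" if "\<forall>j\<le>k. x j > c"
    using that[rule_format, of k] Suc.prems[of k] by auto
  with Suc show ?case by auto
qed (use assms(1,2) in auto)

lemma sets_all_greater:
  fixes x :: "nat \<Rightarrow> 'a \<Rightarrow> real"
  assumes "\<And>j. j \<le> k \<Longrightarrow> x j \<in> borel_measurable N"
  shows "{\<omega>\<in>space N. \<forall>j\<le>k. c < x j \<omega>} \<in> sets N"
proof -
  have "{\<omega>\<in>space N. c < x j \<omega>} \<in> sets N" if "j \<in> {..k}" for j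
    using assms[of j] that by (simp add: borel_measurable_iff_greater)
  then have "{\<omega>\<in>space N. \<forall>j\<in>{..k}. c < x j \<omega>} \<in> sets N"
    by (intro sets.sets_Collect_finite_All) auto
  then show ?thesis by (simp only: Ball_def atMost_iff)
qed

section \<open>Optional stopping on grids\<close>

context drifted_bm begin

text \<open>A visit at time \<open>u\<close> itself does not count. This makes the event match the
  strict inequality between \<open>u\<close> and the last passage time.\<close>

definition hits_after :: "real \<Rightarrow> 'a set" where
  "hits_after u = {\<omega>\<in>space M. \<exists>v>u. X v \<omega> = z}"

text \<open>The open ray of times is exhausted by compact intervals, on which
  \<open>sets_attains_on_interval\<close> applies.\<close>

lemma sets_hits_after [measurable]:
  assumes "u \<ge> 0" shows "hits_after u \<in> events"
proof -
  have "hits_after u = (\<Union>n::nat. {\<omega>\<in>space M. \<exists>v\<in>{u + 1 / Suc n .. u + Suc n}. X v \<omega> = z})"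
  proof -
    have "\<exists>n::nat. u + 1 / Suc n \<le> v \<and> v \<le> u + Suc n" if "v > u" for v
    proof -
      obtain n where n: "1 / Suc n < v - u" using \<open>v > u\<close> nat_approx_posE[of "v - u"] by auto
      obtain k where k: "v - u < real k" using reals_Archimedean2 by blast
      have "1 / real (Suc (max n k)) \<le> 1 / Suc n" by (intro divide_left_mono) auto
      then have "u + 1 / Suc (max n k) \<le> v \<and> v \<le> u + Suc (max n k)" using n k by auto
      then show ?thesis ..
    qed
    moreover have "v > u" if "u + 1 / Suc n \<le> v" for v and n :: nat
      using that by (smt (verit) divide_pos_pos of_nat_0_less_iff zero_less_Suc)
    ultimately show ?thesis unfolding hits_after_def by (intro equalityI subsetI) (simp, metis atLeastAtMost_iff)+
  qed
  moreover have "{\<omega>\<in>space M. \<exists>v\<in>{u + 1 / Suc n .. u + Suc n}. X v \<omega> = z} \<in> events" for n :: nat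
  proof (rule sets_attains_on_interval)
    show "continuous_on {u + 1 / Suc n .. u + Suc n} (\<lambda>t. X t \<omega>)" if "\<omega> \<in> space M" for \<omega>
      by (rule continuous_on_subset[OF continuous_X[OF that]])
         (use assms in \<open>auto intro: order_trans[of _ "u + 1 / Suc n"]\<close>)
    show "X t \<in> borel_measurable M" if "t \<in> {u + 1 / Suc n .. u + Suc n}" for t
      using that assms by (intro measurable_X) (auto intro: order_trans[of _ "u + 1 / Suc n"])
  qed
  ultimately show ?thesis by auto
qed

text \<open>The rate \<open>a * lam + a\<^sup>2 / 2\<close> is 0 for \<open>a = - 2 * lam\<close>,
  the martingale; it is \<open>- lam\<^sup>2 / 2\<close> for \<open>a = - lam\<close>, the decay in
  time; and it is \<open>4 * lam\<^sup>2\<close> for \<open>a = - 4 * lam\<close>, the growth of the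
  second moment. These are the three exponents used below.\<close>

lemma nn_integral_past_exp:
  assumes st: "0 \<le> s" "s < t" and Y: "Y \<in> borel_measurable (F s)"
  shows "(\<integral>\<^sup>+ \<omega>. Y \<omega> * ennreal (exp (a * (X t \<omega> - X s \<omega>))) \<partial>M)
     = ennreal (exp ((a * lam + a\<^sup>2 / 2) * (t - s))) * (\<integral>\<^sup>+ \<omega>. Y \<omega> \<partial>M)"
proof -
  have [measurable]: "Y \<in> borel_measurable M" by (rule measurable_from_subalg[OF subalgebra_F Y])
  have eq: "a * (lam * (t - s)) + a\<^sup>2 * (sqrt (t - s))\<^sup>2 / 2 = (a * lam + a\<^sup>2 / 2) * (t - s)"
    using st by (simp add: algebra_simps)
  have "(\<integral>\<^sup>+ \<omega>. Y \<omega> * ennreal (exp (a * (X t \<omega> - X s \<omega>))) \<partial>M)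
      = (\<integral>\<^sup>+ \<omega>. (\<integral>\<^sup>+ r. ennreal (normal_density (lam * (t - s)) (sqrt (t - s)) r) * (Y \<omega> * ennreal (exp (a * r))) \<partial>lborel) \<partial>M)"
    using nn_integral_past_increment[OF st Y, of "\<lambda>(y, r). y * ennreal (exp (a * r))"] by simp
  also have "\<dots> = (\<integral>\<^sup>+ \<omega>. Y \<omega> * (\<integral>\<^sup>+ r. ennreal (normal_density (lam * (t - s)) (sqrt (t - s)) r) * ennreal (exp (a * r)) \<partial>lborel) \<partial>M)"
    by (intro nn_integral_cong, subst nn_integral_cmult[symmetric]) (auto intro!: nn_integral_cong simp: ac_simps)
  also have "\<dots> = ennreal (exp ((a * lam + a\<^sup>2 / 2) * (t - s))) * (\<integral>\<^sup>+ \<omega>. Y \<omega> \<partial>M)"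
    using st by (subst nn_integral_normal_exp) (simp_all only: eq, simp_all add: nn_integral_multc mult.commute[of "integral\<^sup>N M Y"])
  finally show ?thesis .
qed

lemma nn_integral_exp_X:
  assumes "t > 0"
  shows "(\<integral>\<^sup>+ \<omega>. ennreal (exp (lam * (z - X t \<omega>))) \<partial>M) = ennreal (exp (lam * z - lam\<^sup>2 / 2 * t))"
proof -
  have "(\<integral>\<^sup>+ \<omega>. ennreal (exp (lam * (z - X t \<omega>))) \<partial>M) = (\<integral>\<^sup>+ \<omega>. ennreal (exp (lam * z)) * ennreal (exp (- lam * (X t \<omega> - X 0 \<omega>))) \<partial>M)"
    by (rule nn_integral_cong_AE, use AE_X_0 in eventually_elim)
       (simp add: algebra_simps flip: ennreal_mult' exp_add)
  also have "\<dots> = ennreal (exp (((- lam) * lam + (- lam)\<^sup>2 / 2) * (t - 0))) * ennreal (exp (lam * z))"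
    using assms by (subst nn_integral_past_exp) (auto simp: emeasure_space_1)
  also have "\<dots> = ennreal (exp (lam * z - lam\<^sup>2 / 2 * t))"
    by (simp add: algebra_simps power2_eq_square flip: ennreal_mult' exp_add)
  finally show ?thesis .
qed

abbreviation "stopped_grid c u d k \<omega> \<equiv> stop_below c (\<lambda>j. X (u + real j * d) \<omega>) k"

lemma measurable_X_grid_F:
  "u \<ge> 0 \<Longrightarrow> d > 0 \<Longrightarrow> j \<le> k \<Longrightarrow> X (u + real j * d) \<in> borel_measurable (F (u + real k * d))"
  by (intro measurable_X_F) (auto simp: mult_right_mono)

lemma measurable_stopped_grid:
  assumes ud: "u \<ge> 0" "d > 0" and "k \<le> n"
  shows "stopped_grid c u d k \<in> borel_measurable (F (u + real n * d))"
  using \<open>k \<le> n\<close>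
proof (induction k)
  case 0 then show ?case using measurable_X_grid_F[OF ud, of 0 n] by simp
next
  case (Suc k)
  have G: "{\<omega>\<in>space (F (u + real n * d)). \<forall>j\<le>k. c < X (u + real j * d) \<omega>} \<in> sets (F (u + real n * d))"
    using Suc.prems by (intro sets_all_greater measurable_X_grid_F[OF ud]) simp
  have "(\<lambda>\<omega>. if \<forall>j\<le>k. X (u + real j * d) \<omega> > c then X (u + real (Suc k) * d) \<omega> else stopped_grid c u d k \<omega>)
      \<in> borel_measurable (F (u + real n * d))"
    using Suc.prems by (intro measurable_If G Suc.IH measurable_X_grid_F[OF ud]) simp_all
  then show ?case by simp
qed

lemma measurable_stopped_grid' [measurable]:
  "u \<ge> 0 \<Longrightarrow> d > 0 \<Longrightarrow> stopped_grid c u d k \<in> borel_measurable M"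
  by (rule measurable_from_subalg[OF subalgebra_F measurable_stopped_grid[OF _ _ order_refl]])

text \<open>In one grid step the stopped paths keep their value, and the others are multiplied by
  the exponential of an increment independent of the past. The parameter \<open>p\<close> serves the
  martingale (\<open>p = 1\<close>, factor 1) and its square (\<open>p = 2\<close>, factor
  \<open>exp (4 * lam\<^sup>2 * d)\<close>).\<close>

lemma nn_integral_stopped_exp_Suc:
  fixes p c :: real
  assumes ud: "u \<ge> 0" "d > 0" and A: "A \<in> sets (F u)"
  defines "W \<equiv> \<lambda>k \<omega>. exp (2 * lam * p * (z - stopped_grid c u d k \<omega>))"
  defines "G \<equiv> \<lambda>k. {\<omega>\<in>space M. \<forall>j\<le>k. X (u + real j * d) \<omega> > c}"
  shows "(\<integral>\<^sup>+ \<omega>. indicator A \<omega> * ennreal (W (Suc k) \<omega>) \<partial>M)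
     = (\<integral>\<^sup>+ \<omega>. indicator A \<omega> * (indicator (- G k) \<omega> * ennreal (W k \<omega>)) \<partial>M)
     + ennreal (exp (2 * lam\<^sup>2 * p * (p - 1) * d)) * (\<integral>\<^sup>+ \<omega>. indicator A \<omega> * (indicator (G k) \<omega> * ennreal (W k \<omega>)) \<partial>M)"
proof -
  let ?s = "u + real k * d" and ?t = "u + real (Suc k) * d"
  have st: "0 \<le> ?s" "?s < ?t" "?t - ?s = d" using ud by (auto simp: algebra_simps)
  have G: "G k \<in> sets (F ?s)"
  proof -
    have "{\<omega>\<in>space (F ?s). \<forall>j\<le>k. c < X (u + real j * d) \<omega>} \<in> sets (F ?s)"
      by (intro sets_all_greater measurable_X_grid_F[OF ud])
    then show ?thesis by (simp only: G_def space_natural_filtration)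
  qed
  have A': "A \<in> sets (F ?s)" using ud by (intro sets_F_mono[OF _ A]) simp
  have [measurable]: "A \<in> events" "G k \<in> events" using A' G sets_F_events by auto
  have [measurable]: "W k \<in> borel_measurable M" unfolding W_def using ud by measurable
  have W: "W k \<in> borel_measurable (F ?s)"
    unfolding W_def using measurable_stopped_grid[OF ud order_refl] by measurable
  have "(\<integral>\<^sup>+ \<omega>. indicator A \<omega> * ennreal (W (Suc k) \<omega>) \<partial>M)
     = (\<integral>\<^sup>+ \<omega>. indicator A \<omega> * (indicator (- G k) \<omega> * ennreal (W k \<omega>))
          + (indicator A \<omega> * (indicator (G k) \<omega> * ennreal (W k \<omega>))) * ennreal (exp (- 2 * lam * p * (X ?t \<omega> - X ?s \<omega>))) \<partial>M)"
  proof (rule nn_integral_cong)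
    fix \<omega> assume \<omega>: "\<omega> \<in> space M"
    show "indicator A \<omega> * ennreal (W (Suc k) \<omega>) = indicator A \<omega> * (indicator (- G k) \<omega> * ennreal (W k \<omega>))
          + (indicator A \<omega> * (indicator (G k) \<omega> * ennreal (W k \<omega>))) * ennreal (exp (- 2 * lam * p * (X ?t \<omega> - X ?s \<omega>)))"
    proof (cases "\<omega> \<in> G k")
      case True
      then have "stopped_grid c u d k \<omega> = X ?s \<omega>" "stopped_grid c u d (Suc k) \<omega> = X ?t \<omega>"
        by (intro stop_below_eq; auto simp: G_def)+
      then have "W (Suc k) \<omega> = W k \<omega> * exp (- 2 * lam * p * (X ?t \<omega> - X ?s \<omega>))"
        unfolding W_def by (simp add: algebra_simps flip: exp_add)
      then show ?thesis using True by (simp add: ennreal_mult'' mult.assoc)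
    next
      case False
      then have "W (Suc k) \<omega> = W k \<omega>" using \<omega> by (auto simp: W_def G_def)
      then show ?thesis using False by simp
    qed
  qed
  also have "\<dots> = (\<integral>\<^sup>+ \<omega>. indicator A \<omega> * (indicator (- G k) \<omega> * ennreal (W k \<omega>)) \<partial>M)
     + (\<integral>\<^sup>+ \<omega>. (indicator A \<omega> * (indicator (G k) \<omega> * ennreal (W k \<omega>))) * ennreal (exp ((- 2 * lam * p) * (X ?t \<omega> - X ?s \<omega>))) \<partial>M)"
    using ud by (intro nn_integral_add) auto
  also have "(\<integral>\<^sup>+ \<omega>. (indicator A \<omega> * (indicator (G k) \<omega> * ennreal (W k \<omega>))) * ennreal (exp ((- 2 * lam * p) * (X ?t \<omega> - X ?s \<omega>))) \<partial>M)
     = ennreal (exp (((- 2 * lam * p) * lam + (- 2 * lam * p)\<^sup>2 / 2) * (?t - ?s))) * (\<integral>\<^sup>+ \<omega>. indicator A \<omega> * (indicator (G k) \<omega> * ennreal (W k \<omega>)) \<partial>M)"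
    using A' G W by (intro nn_integral_past_exp[OF st(1,2)]) auto
  also have "((- 2 * lam * p) * lam + (- 2 * lam * p)\<^sup>2 / 2) * (?t - ?s) = 2 * lam\<^sup>2 * p * (p - 1) * d"
    unfolding st(3) by (simp add: power2_eq_square algebra_simps)
  finally show ?thesis .
qed

lemma stopped_exp_martingale:
  assumes ud: "u \<ge> 0" "d > 0" and A: "A \<in> sets (F u)"
  shows "(\<integral>\<^sup>+ \<omega>. indicator A \<omega> * ennreal (exp (2 * lam * (z - stopped_grid c u d k \<omega>))) \<partial>M)
     = (\<integral>\<^sup>+ \<omega>. indicator A \<omega> * ennreal (exp (2 * lam * (z - X u \<omega>))) \<partial>M)"
proof (induction k)
  case (Suc k)
  let ?G = "{\<omega>\<in>space M. \<forall>j\<le>k. X (u + real j * d) \<omega> > c}"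
  have [measurable]: "?G \<in> events" using ud by (intro sets_all_greater measurable_X) simp
  have [measurable]: "A \<in> events" using A by (rule sets_F_events)
  have "(\<integral>\<^sup>+ \<omega>. indicator A \<omega> * ennreal (exp (2 * lam * (z - stopped_grid c u d (Suc k) \<omega>))) \<partial>M)
     = (\<integral>\<^sup>+ \<omega>. indicator A \<omega> * (indicator (- ?G) \<omega> * ennreal (exp (2 * lam * (z - stopped_grid c u d k \<omega>)))) \<partial>M)
     + (\<integral>\<^sup>+ \<omega>. indicator A \<omega> * (indicator ?G \<omega> * ennreal (exp (2 * lam * (z - stopped_grid c u d k \<omega>)))) \<partial>M)"
    using nn_integral_stopped_exp_Suc[OF ud A, of 1 c k] by simp
  also have "\<dots> = (\<integral>\<^sup>+ \<omega>. indicator A \<omega> * ennreal (exp (2 * lam * (z - stopped_grid c u d k \<omega>))) \<partial>M)"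
    using ud by (subst nn_integral_add[symmetric]) (auto intro!: nn_integral_cong split: split_indicator)
  finally show ?case using Suc by simp
qed simp

text \<open>The paths already stopped do not grow; granting them the growth factor of the others
  lets the two parts be joined again. The bound depends on \<open>k\<close> and \<open>d\<close>
  only through the elapsed time, hence it survives refinement of the mesh.\<close>

lemma stopped_exp_second_moment:
  assumes ud: "u \<ge> 0" "d > 0" and A: "A \<in> sets (F u)"
  shows "(\<integral>\<^sup>+ \<omega>. indicator A \<omega> * ennreal ((exp (2 * lam * (z - stopped_grid c u d k \<omega>)))\<^sup>2) \<partial>M)
     \<le> ennreal (exp (4 * lam\<^sup>2 * (real k * d))) * (\<integral>\<^sup>+ \<omega>. indicator A \<omega> * ennreal ((exp (2 * lam * (z - X u \<omega>)))\<^sup>2) \<partial>M)"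
proof (induction k)
  case (Suc k)
  let ?G = "{\<omega>\<in>space M. \<forall>j\<le>k. X (u + real j * d) \<omega> > c}"
  let ?W = "\<lambda>k \<omega>. ennreal ((exp (2 * lam * (z - stopped_grid c u d k \<omega>)))\<^sup>2)"
  have sq: "(exp (2 * lam * y))\<^sup>2 = exp (2 * lam * 2 * y)" for y
    by (simp add: power2_eq_square algebra_simps flip: exp_add)
  have [measurable]: "?G \<in> events" using ud by (intro sets_all_greater measurable_X) simp
  have [measurable]: "A \<in> events" using A by (rule sets_F_events)
  have "(\<integral>\<^sup>+ \<omega>. indicator A \<omega> * ?W (Suc k) \<omega> \<partial>M)
     = (\<integral>\<^sup>+ \<omega>. indicator A \<omega> * (indicator (- ?G) \<omega> * ?W k \<omega>) \<partial>M)
     + ennreal (exp (4 * lam\<^sup>2 * d)) * (\<integral>\<^sup>+ \<omega>. indicator A \<omega> * (indicator ?G \<omega> * ?W k \<omega>) \<partial>M)"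
    using nn_integral_stopped_exp_Suc[OF ud A, of 2 c k] unfolding sq by simp
  also have "\<dots> \<le> ennreal (exp (4 * lam\<^sup>2 * d)) * (\<integral>\<^sup>+ \<omega>. indicator A \<omega> * (indicator (- ?G) \<omega> * ?W k \<omega>) \<partial>M)
     + ennreal (exp (4 * lam\<^sup>2 * d)) * (\<integral>\<^sup>+ \<omega>. indicator A \<omega> * (indicator ?G \<omega> * ?W k \<omega>) \<partial>M)"
  proof (rule add_right_mono)
    have "1 \<le> ennreal (exp (4 * lam\<^sup>2 * d))" using ud by (simp add: ennreal_ge_1)
    then show "x \<le> ennreal (exp (4 * lam\<^sup>2 * d)) * x" for x
      using mult_right_mono[of 1 "ennreal (exp (4 * lam\<^sup>2 * d))" x] by simp
  qed
  also have "\<dots> = ennreal (exp (4 * lam\<^sup>2 * d)) * (\<integral>\<^sup>+ \<omega>. indicator A \<omega> * ?W k \<omega> \<partial>M)"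
    using ud unfolding distrib_left[symmetric]
    by (subst nn_integral_add[symmetric]) (auto intro!: nn_integral_cong arg_cong2[where f="(*)"] split: split_indicator)
  also have "\<dots> \<le> ennreal (exp (4 * lam\<^sup>2 * d)) * (ennreal (exp (4 * lam\<^sup>2 * (real k * d))) * (\<integral>\<^sup>+ \<omega>. indicator A \<omega> * ennreal ((exp (2 * lam * (z - X u \<omega>)))\<^sup>2) \<partial>M))"
    by (rule mult_left_mono[OF Suc]) simp
  also have "\<dots> = ennreal (exp (4 * lam\<^sup>2 * (real (Suc k) * d))) * (\<integral>\<^sup>+ \<omega>. indicator A \<omega> * ennreal ((exp (2 * lam * (z - X u \<omega>)))\<^sup>2) \<partial>M)"
  proof -
    have "exp (4 * lam\<^sup>2 * d) * exp (4 * lam\<^sup>2 * (real k * d)) = exp (4 * lam\<^sup>2 * (real (Suc k) * d))"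
      by (simp add: algebra_simps flip: exp_add)
    then show ?thesis by (simp only: mult.assoc[symmetric] ennreal_mult'[OF exp_ge_zero, symmetric])
  qed
  finally show ?case .
qed simp

text \<open>On a grid fine enough, a path that hits \<open>z\<close> comes below \<open>z + \<epsilon>\<close>, where the stopped exponential is at least
  \<open>exp (- 2 lam \<epsilon>)\<close>.\<close>

lemma hits_after_upper:
  assumes u: "u \<ge> 0" and A: "A \<in> sets (F u)"
  shows "emeasure M (A \<inter> hits_after u) \<le> (\<integral>\<^sup>+ \<omega>. indicator A \<omega> * ennreal (exp (2 * lam * (z - X u \<omega>))) \<partial>M)"
    (is "_ \<le> ?R")
proof -
  have [measurable]: "A \<in> events" using A by (rule sets_F_events)
  have e: "ennreal (exp (- 2 * lam * e)) * emeasure M (A \<inter> hits_after u) \<le> ?R" if "e > 0" for e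
  proof -
    \<comment> \<open>With mesh \<open>1 / Suc m\<close> and \<open>Suc m * Suc m\<close> steps, the
      grid gets finer and its horizon grows at once, so it eventually resolves every visit.\<close>
    define E where "E m = {\<omega>\<in>space M. \<exists>k\<le>Suc m * Suc m. X (u + real k * (1 / Suc m)) \<omega> \<le> z + e}" for m :: nat
    have [measurable]: "E m \<in> events" for m
    proof -
      have "E m = space M - {\<omega>\<in>space M. \<forall>k\<le>Suc m * Suc m. z + e < X (u + real k * (1 / Suc m)) \<omega>}"
        by (auto simp: E_def not_less)
      also have "\<dots> \<in> events" using u by (intro sets.Diff sets.top sets_all_greater measurable_X) simp
      finally show ?thesis .
    qed
    have bound: "ennreal (exp (- 2 * lam * e)) * emeasure M (A \<inter> E m) \<le> ?R" for m
    proof -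
      have "ennreal (exp (- 2 * lam * e)) * emeasure M (A \<inter> E m)
          = (\<integral>\<^sup>+ \<omega>. ennreal (exp (- 2 * lam * e)) * indicator (A \<inter> E m) \<omega> \<partial>M)"
        by (simp add: nn_integral_cmult)
      also have "\<dots> \<le> (\<integral>\<^sup>+ \<omega>. indicator A \<omega> * ennreal (exp (2 * lam * (z - stopped_grid (z + e) u (1 / Suc m) (Suc m * Suc m) \<omega>))) \<partial>M)"
      proof (rule nn_integral_mono)
        fix \<omega> assume \<omega>: "\<omega> \<in> space M"
        show "ennreal (exp (- 2 * lam * e)) * indicator (A \<inter> E m) \<omega>
          \<le> indicator A \<omega> * ennreal (exp (2 * lam * (z - stopped_grid (z + e) u (1 / Suc m) (Suc m * Suc m) \<omega>)))"
        proof (cases "\<omega> \<in> A \<inter> E m")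
          case True
          then obtain k where "k \<le> Suc m * Suc m" "X (u + real k * (1 / Suc m)) \<omega> \<le> z + e" by (auto simp: E_def)
          then have "stopped_grid (z + e) u (1 / Suc m) (Suc m * Suc m) \<omega> \<le> z + e"
            by (intro stop_below_le[of _ k])
          then have "2 * lam * (- e) \<le> 2 * lam * (z - stopped_grid (z + e) u (1 / Suc m) (Suc m * Suc m) \<omega>)"
            using lam_pos by (intro mult_left_mono) simp_all
          then have "exp (- 2 * lam * e) \<le> exp (2 * lam * (z - stopped_grid (z + e) u (1 / Suc m) (Suc m * Suc m) \<omega>))"
            by (simp only: exp_le_cancel_iff mult_minus_left mult_minus_right)
          then show ?thesis using True by (simp only: indicator_simps Int_iff mult_1 mult_1_right ennreal_leI)
        qed auto
      qed
      also have "\<dots> = ?R" using u A by (intro stopped_exp_martingale) auto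
      finally show ?thesis .
    qed
    \<comment> \<open>The events \<open>E m\<close> need not increase with \<open>m\<close>; the
      intersections over tails do, so continuity from below applies to these.\<close>
    have sub: "A \<inter> hits_after u \<subseteq> (\<Union>n. A \<inter> (\<Inter>m\<in>{n..}. E m))"
    proof
      fix \<omega> assume "\<omega> \<in> A \<inter> hits_after u"
      then obtain v where \<omega>: "\<omega> \<in> A" "\<omega> \<in> space M" and v: "v > u" "X v \<omega> = z" by (auto simp: hits_after_def)
      have "v \<ge> 0" using u v by simp
      with continuous_X[OF \<omega>(2)] \<open>e > 0\<close> have "\<exists>\<delta>>0. \<forall>s\<in>{0..}. \<bar>s - v\<bar> < \<delta> \<longrightarrow> \<bar>X s \<omega> - X v \<omega>\<bar> < e"
        unfolding continuous_on_iff dist_real_def by auto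
      then obtain \<delta> where \<delta>: "\<delta> > 0" "\<And>s. s \<ge> 0 \<Longrightarrow> \<bar>s - v\<bar> < \<delta> \<Longrightarrow> \<bar>X s \<omega> - z\<bar> < e"
        using v(2) by auto
      obtain n1 where n1: "1 / Suc n1 < \<delta>" using \<delta>(1) nat_approx_posE by blast
      obtain n2 where n2: "v - u < real n2" using reals_Archimedean2 by blast
      have "\<omega> \<in> E m" if m: "m \<ge> max n1 n2" for m
      proof -
        define k where "k = nat \<lfloor>(v - u) * Suc m\<rfloor>"
        have pos: "(v - u) * Suc m \<ge> 0" using v by simp
        then have k: "real k \<le> (v - u) * Suc m" "(v - u) * Suc m - 1 < real k" by (auto simp: k_def)
        have "(v - u) * Suc m \<le> real (Suc m) * Suc m" using n2 m by (intro mult_right_mono) auto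
        from order_trans[OF k(1) this] have "real k \<le> real (Suc m * Suc m)" by (simp only: of_nat_mult)
        then have kN: "k \<le> Suc m * Suc m" by (simp only: of_nat_le_iff)
        have "real k * (1 / Suc m) \<le> v - u" using k(1) by (simp add: field_simps)
        moreover have "v - u - 1 / Suc m < real k * (1 / Suc m)"
          using divide_strict_right_mono[OF k(2), of "real (Suc m)"] by (simp add: diff_divide_distrib)
        moreover have "1 / real (Suc m) \<le> 1 / Suc n1" using m by (intro divide_left_mono) auto
        ultimately have "\<bar>(u + real k * (1 / Suc m)) - v\<bar> < \<delta>" using n1 by auto
        from \<delta>(2)[OF _ this] u have "X (u + real k * (1 / Suc m)) \<omega> \<le> z + e" by auto
        with kN \<omega> show ?thesis by (auto simp: E_def)
      qed
      with \<omega> show "\<omega> \<in> (\<Union>n. A \<inter> (\<Inter>m\<in>{n..}. E m))" by (intro UN_I[of "max n1 n2"]) auto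
    qed
    have "emeasure M (A \<inter> hits_after u) \<le> emeasure M (\<Union>n. A \<inter> (\<Inter>m\<in>{n..}. E m))"
      by (rule emeasure_mono[OF sub]) measurable
    also have "\<dots> = (SUP n. emeasure M (A \<inter> (\<Inter>m\<in>{n..}. E m)))"
      by (rule SUP_emeasure_incseq[symmetric]) (force simp: incseq_def)+
    finally have "ennreal (exp (- 2 * lam * e)) * emeasure M (A \<inter> hits_after u)
        \<le> ennreal (exp (- 2 * lam * e)) * (SUP n. emeasure M (A \<inter> (\<Inter>m\<in>{n..}. E m)))"
      by (rule mult_left_mono) simp
    also have "\<dots> = (SUP n. ennreal (exp (- 2 * lam * e)) * emeasure M (A \<inter> (\<Inter>m\<in>{n..}. E m)))"
      by (rule SUP_mult_left_ennreal)
    also have "\<dots> \<le> ?R"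
    proof (rule SUP_least)
      fix n
      have "ennreal (exp (- 2 * lam * e)) * emeasure M (A \<inter> (\<Inter>m\<in>{n..}. E m)) \<le> ennreal (exp (- 2 * lam * e)) * emeasure M (A \<inter> E n)"
        by (intro mult_left_mono emeasure_mono) auto
      with bound[of n] show "ennreal (exp (- 2 * lam * e)) * emeasure M (A \<inter> (\<Inter>m\<in>{n..}. E m)) \<le> ?R" by simp
    qed
    finally show ?thesis .
  qed
  have "(\<lambda>n. ennreal (exp (- 2 * lam * (1 / Suc n)) * prob (A \<inter> hits_after u))) \<longlonglongrightarrow> ennreal (exp (- 2 * lam * 0) * prob (A \<inter> hits_after u))"
    using LIMSEQ_inverse_real_of_nat unfolding inverse_eq_divide by (intro tendsto_intros)
  moreover have "ennreal (exp (- 2 * lam * (1 / Suc n)) * prob (A \<inter> hits_after u)) \<le> ?R" for n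
    using e[of "1 / Suc n"] by (simp add: emeasure_eq_measure ennreal_mult')
  ultimately have "ennreal (exp (- 2 * lam * 0) * prob (A \<inter> hits_after u)) \<le> ?R"
    by (intro LIMSEQ_le_const2) blast+
  then show ?thesis by (simp add: emeasure_eq_measure)
qed

text \<open>The oscillation of the path between grid points bounds the overshoot of the stopped exponential; on the event of
  a large oscillation the second moment takes over.\<close>

lemma hits_after_lower:
  assumes u: "u \<ge> 0" and A: "A \<in> sets (F u)" and above: "\<And>\<omega>. \<omega> \<in> A \<Longrightarrow> X u \<omega> > z"
  shows "(\<integral>\<^sup>+ \<omega>. indicator A \<omega> * ennreal (exp (2 * lam * (z - X u \<omega>))) \<partial>M) \<le> emeasure M (A \<inter> hits_after u)"
    (is "?R \<le> _")
proof -
  have [measurable]: "A \<in> events" using A by (rule sets_F_events)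
  have Asp: "A \<subseteq> space M" by (rule sets.sets_into_space) simp
  let ?pH = "prob (A \<inter> hits_after u)"
  \<comment> \<open>Three limits are nested: here the mesh goes to 0 for a fixed horizon
    \<open>Suc m\<close> and a fixed tolerance \<open>\<eta>\<close> for the jumps; the horizon and
    then \<open>\<eta>\<close> follow.\<close>
  have step: "?R \<le> ennreal (exp (2 * lam * \<eta>) * ?pH + 1 / Suc m + exp (lam * z - lam\<^sup>2 / 2 * (u + Suc m)))"
    if "\<eta> > 0" for \<eta> and m :: nat
  proof -
    \<comment> \<open>A truncation level. The second moment up to the horizon is at most
      \<open>exp (4 * lam\<^sup>2 * Suc m)\<close>, so division by \<open>K\<close> leaves
      \<open>1 / Suc m\<close>.\<close>
    define K where "K = exp (4 * lam\<^sup>2 * Suc m) * Suc m"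
    have K: "K > 0" by (simp add: K_def)
    define S where "S n \<omega> = stopped_grid z u (1 / Suc n) (Suc m * Suc n) \<omega>" for n \<omega>
    define Osc where "Osc n = {\<omega>\<in>space M. \<not> (\<forall>k<Suc m * Suc n. \<bar>X (u + real (Suc k) * (1 / Suc n)) \<omega> - X (u + real k * (1 / Suc n)) \<omega>\<bar> \<le> \<eta>)}" for n
    have end_grid: "u + real (Suc m * Suc n) * (1 / Suc n) = u + Suc m" for n
      by (simp add: field_simps)
    have Osc_meas [measurable]: "Osc n \<in> events" for n
    proof -
      have "{\<omega>\<in>space M. \<bar>X (u + real (Suc k) * (1 / Suc n)) \<omega> - X (u + real k * (1 / Suc n)) \<omega>\<bar> \<le> \<eta>} \<in> events" for k
        using u by (intro borel_measurable_le borel_measurable_abs borel_measurable_diff measurable_X) auto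
      then have "{\<omega>\<in>space M. \<forall>k\<in>{..<Suc m * Suc n}. \<bar>X (u + real (Suc k) * (1 / Suc n)) \<omega> - X (u + real k * (1 / Suc n)) \<omega>\<bar> \<le> \<eta>} \<in> events"
        by (intro sets.sets_Collect_finite_All) auto
      then have "space M - {\<omega>\<in>space M. \<forall>k<Suc m * Suc n. \<bar>X (u + real (Suc k) * (1 / Suc n)) \<omega> - X (u + real k * (1 / Suc n)) \<omega>\<bar> \<le> \<eta>} \<in> events"
        by (simp only: Ball_def lessThan_iff sets.compl_sets)
      also have "space M - {\<omega>\<in>space M. \<forall>k<Suc m * Suc n. \<bar>X (u + real (Suc k) * (1 / Suc n)) \<omega> - X (u + real k * (1 / Suc n)) \<omega>\<bar> \<le> \<eta>} = Osc n"
        unfolding Osc_def by blast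
      finally show ?thesis .
    qed
    have S_meas [measurable]: "S n \<in> borel_measurable M" for n
      unfolding S_def using u by (intro measurable_stopped_grid') auto
    \<comment> \<open>The first term covers paths that reach the lower ray without a large jump,
      hence with an overshoot of at most \<open>\<eta>\<close>; the last covers paths above
      \<open>z\<close> on the whole grid. On \<open>Osc n\<close> the inequality between
      \<open>W\<close> and \<open>K + W\<^sup>2 / K\<close> supplies the two terms in
      between.\<close>
    have pointwise: "exp (2 * lam * (z - S n \<omega>))
        \<le> exp (2 * lam * \<eta>) * indicator (A \<inter> hits_after u) \<omega> + K * indicator (Osc n) \<omega>
          + inverse K * (exp (2 * lam * (z - S n \<omega>)))\<^sup>2 + exp (lam * (z - X (u + Suc m) \<omega>))"
      if \<omega>: "\<omega> \<in> A" for n \<omega>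
    proof -
      let ?W = "exp (2 * lam * (z - S n \<omega>))"
      let ?x = "\<lambda>j. X (u + real j * (1 / Suc n)) \<omega>"
      have \<omega>M: "\<omega> \<in> space M" using \<omega> Asp by auto
      have nn: "0 \<le> inverse K * ?W\<^sup>2" "0 \<le> exp (lam * (z - X (u + Suc m) \<omega>))"
        "0 \<le> exp (2 * lam * \<eta>) * indicator (A \<inter> hits_after u) \<omega>" "0 \<le> K * indicator (Osc n) \<omega>" using K by auto
      consider (high) "\<forall>j\<le>Suc m * Suc n. ?x j > z" | (osc) "\<omega> \<in> Osc n"
        | (hit) j where "j \<le> Suc m * Suc n" "?x j \<le> z" "\<omega> \<notin> Osc n" by (meson not_less)
      then show ?thesis
      proof cases
        case high
        then have "S n \<omega> = ?x (Suc m * Suc n)" unfolding S_def by (intro stop_below_eq) auto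
        then have S: "S n \<omega> = X (u + Suc m) \<omega>" "S n \<omega> > z" using high[rule_format, OF order_refl] by (simp_all only: end_grid)
        \<comment> \<open>As the exponent is not positive, halving it gives an upper bound, whose
          mean tends to 0 as the horizon grows.\<close>
        have "lam * (z - S n \<omega>) \<le> 0" using S(2) lam_pos by (simp add: mult_nonneg_nonpos)
        then have "?W \<le> exp (lam * (z - X (u + Suc m) \<omega>))" unfolding S(1)[symmetric] by simp
        with nn show ?thesis by linarith
      next
        case osc
        have "?W \<le> K + inverse K * ?W\<^sup>2"
        proof (cases "?W \<le> K")
          case False
          then have "K * ?W \<le> ?W * ?W" using K by (intro mult_right_mono) auto
          then have "?W \<le> inverse K * ?W\<^sup>2" using K by (simp add: power2_eq_square field_simps)
          then show ?thesis using K by simp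
        next
          case True
          then show ?thesis using nn(1) by linarith
        qed
        moreover have "K * indicator (Osc n) \<omega> = K" using osc by simp
        ultimately show ?thesis using nn by linarith
      next
        case hit
        have "X u \<omega> > z" using above \<omega> by simp
        have "\<exists>v\<ge>u. v \<le> u + real j * (1 / Suc n) \<and> X v \<omega> = z"
        proof (rule IVT2')
          show "continuous_on {u..u + real j * (1 / Suc n)} (\<lambda>v. X v \<omega>)"
            using u by (intro continuous_on_subset[OF continuous_X[OF \<omega>M]]) auto
        qed (use hit \<open>X u \<omega> > z\<close> in auto)
        then obtain v where "v \<ge> u" "X v \<omega> = z" by auto
        then have "\<omega> \<in> hits_after u" using \<open>X u \<omega> > z\<close> \<omega>M by (auto simp: hits_after_def intro!: exI[of _ v] intro: order.not_eq_order_implies_strict)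
        have "S n \<omega> \<ge> z - \<eta>"
          unfolding S_def
        proof (rule stop_below_ge)
          fix i assume "i < Suc m * Suc n"
          then show "\<bar>X (u + real (Suc i) * (1 / Suc n)) \<omega> - X (u + real i * (1 / Suc n)) \<omega>\<bar> \<le> \<eta>"
            using hit(3) \<omega>M by (auto simp: Osc_def)
        qed (use \<open>X u \<omega> > z\<close> \<open>\<eta> > 0\<close> in auto)
        then have "?W \<le> exp (2 * lam * \<eta>)" using lam_pos by (simp add: mult_left_mono)
        moreover have "exp (2 * lam * \<eta>) * indicator (A \<inter> hits_after u) \<omega> = exp (2 * lam * \<eta>)"
          using \<omega> \<open>\<omega> \<in> hits_after u\<close> by simp
        ultimately show ?thesis using nn by linarith
      qed
    qed
    have bound: "?R \<le> ennreal (exp (2 * lam * \<eta>) * ?pH + K * prob (Osc n) + 1 / Suc m + exp (lam * z - lam\<^sup>2 / 2 * (u + Suc m)))" for n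
    proof -
      have "?R = (\<integral>\<^sup>+ \<omega>. indicator A \<omega> * ennreal (exp (2 * lam * (z - S n \<omega>))) \<partial>M)"
        unfolding S_def by (rule stopped_exp_martingale[symmetric]) (use u A in auto)
      also have "\<dots> \<le> (\<integral>\<^sup>+ \<omega>. ennreal (exp (2 * lam * \<eta>)) * indicator (A \<inter> hits_after u) \<omega> + (ennreal K * indicator (Osc n) \<omega>
          + (ennreal (inverse K) * (indicator A \<omega> * ennreal ((exp (2 * lam * (z - S n \<omega>)))\<^sup>2)) + ennreal (exp (lam * (z - X (u + Suc m) \<omega>))))) \<partial>M)"
      proof (rule nn_integral_mono)
        fix \<omega>
        show "indicator A \<omega> * ennreal (exp (2 * lam * (z - S n \<omega>)))
          \<le> ennreal (exp (2 * lam * \<eta>)) * indicator (A \<inter> hits_after u) \<omega> + (ennreal K * indicator (Osc n) \<omega>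
          + (ennreal (inverse K) * (indicator A \<omega> * ennreal ((exp (2 * lam * (z - S n \<omega>)))\<^sup>2)) + ennreal (exp (lam * (z - X (u + Suc m) \<omega>)))))"
        proof (cases "\<omega> \<in> A")
          case True
          have "ennreal (exp (2 * lam * (z - S n \<omega>))) \<le> ennreal (exp (2 * lam * \<eta>) * indicator (A \<inter> hits_after u) \<omega> + K * indicator (Osc n) \<omega>
              + inverse K * (exp (2 * lam * (z - S n \<omega>)))\<^sup>2 + exp (lam * (z - X (u + Suc m) \<omega>)))"
            by (rule ennreal_leI[OF pointwise[OF True]])
          also have "\<dots> = ennreal (exp (2 * lam * \<eta>)) * indicator (A \<inter> hits_after u) \<omega> + (ennreal K * indicator (Osc n) \<omega>
              + (ennreal (inverse K) * ennreal ((exp (2 * lam * (z - S n \<omega>)))\<^sup>2) + ennreal (exp (lam * (z - X (u + Suc m) \<omega>)))))"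
            using K by (simp add: ennreal_plus ennreal_mult' add.assoc flip: ennreal_indicator del: ennreal_plus) (simp add: ennreal_plus ennreal_mult')
          finally show ?thesis using True by simp
        qed simp
      qed
      also have "\<dots> = ennreal (exp (2 * lam * \<eta>)) * emeasure M (A \<inter> hits_after u) + (ennreal K * emeasure M (Osc n)
          + (ennreal (inverse K) * (\<integral>\<^sup>+ \<omega>. indicator A \<omega> * ennreal ((exp (2 * lam * (z - S n \<omega>)))\<^sup>2) \<partial>M) + (\<integral>\<^sup>+ \<omega>. ennreal (exp (lam * (z - X (u + Suc m) \<omega>))) \<partial>M)))"
        using u by (simp add: nn_integral_add nn_integral_cmult)
      also have "\<dots> \<le> ennreal (exp (2 * lam * \<eta>)) * ennreal ?pH + (ennreal K * ennreal (prob (Osc n))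
          + (ennreal (inverse K) * ennreal (exp (4 * lam\<^sup>2 * Suc m)) + ennreal (exp (lam * z - lam\<^sup>2 / 2 * (u + Suc m)))))"
      proof (intro add_mono mult_left_mono)
        show "(\<integral>\<^sup>+ \<omega>. ennreal (exp (lam * (z - X (u + Suc m) \<omega>))) \<partial>M) \<le> ennreal (exp (lam * z - lam\<^sup>2 / 2 * (u + Suc m)))"
          using u by (subst nn_integral_exp_X) auto
        have "(\<integral>\<^sup>+ \<omega>. indicator A \<omega> * ennreal ((exp (2 * lam * (z - S n \<omega>)))\<^sup>2) \<partial>M)
          \<le> ennreal (exp (4 * lam\<^sup>2 * (real (Suc m * Suc n) * (1 / Suc n)))) * (\<integral>\<^sup>+ \<omega>. indicator A \<omega> * ennreal ((exp (2 * lam * (z - X u \<omega>)))\<^sup>2) \<partial>M)"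
          unfolding S_def using u A by (intro stopped_exp_second_moment) auto
        also have "\<dots> \<le> ennreal (exp (4 * lam\<^sup>2 * Suc m)) * (\<integral>\<^sup>+ \<omega>. 1 \<partial>M)"
        proof (rule mult_mono)
          show "(\<integral>\<^sup>+ \<omega>. indicator A \<omega> * ennreal ((exp (2 * lam * (z - X u \<omega>)))\<^sup>2) \<partial>M) \<le> (\<integral>\<^sup>+ \<omega>. 1 \<partial>M)"
          proof (rule nn_integral_mono)
            fix \<omega>
            have "(exp (2 * lam * (z - X u \<omega>)))\<^sup>2 \<le> 1" if "\<omega> \<in> A"
              using above[OF that] lam_pos by (intro power_le_one) (auto simp: mult_nonneg_nonpos)
            then show "indicator A \<omega> * ennreal ((exp (2 * lam * (z - X u \<omega>)))\<^sup>2) \<le> 1"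
              by (auto simp: indicator_def ennreal_le_1)
          qed
          have "real (Suc m * Suc n) * (1 / Suc n) = Suc m" by (simp add: field_simps)
          then show "ennreal (exp (4 * lam\<^sup>2 * (real (Suc m * Suc n) * (1 / Suc n)))) \<le> ennreal (exp (4 * lam\<^sup>2 * Suc m))"
            by (simp only: order_refl)
        qed auto
        finally show "(\<integral>\<^sup>+ \<omega>. indicator A \<omega> * ennreal ((exp (2 * lam * (z - S n \<omega>)))\<^sup>2) \<partial>M) \<le> ennreal (exp (4 * lam\<^sup>2 * Suc m))"
          by (simp add: emeasure_space_1)
      qed (auto simp: emeasure_eq_measure)
      also have "\<dots> = ennreal (exp (2 * lam * \<eta>) * ?pH + (K * prob (Osc n) + (inverse K * exp (4 * lam\<^sup>2 * Suc m) + exp (lam * z - lam\<^sup>2 / 2 * (u + Suc m)))))"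
        using K by (simp add: ennreal_plus ennreal_mult' measure_nonneg)
      also have "inverse K * exp (4 * lam\<^sup>2 * Suc m) = 1 / Suc m"
        unfolding K_def by (simp add: inverse_eq_divide del: of_nat_Suc)
      finally show ?thesis by (simp only: add.assoc)
    qed
    \<comment> \<open>On the compact time interval each path is uniformly continuous, so it leaves
      \<open>Osc n\<close> for good once the mesh is fine enough; dominated convergence does the
      rest.\<close>
    have "(\<lambda>n. prob (Osc n)) \<longlonglongrightarrow> 0"
    proof -
      have "(\<lambda>n. \<integral>\<omega>. indicator (Osc n) \<omega> \<partial>M) \<longlonglongrightarrow> (\<integral>\<omega>. (0::real) \<partial>M)"
      proof (rule integral_dominated_convergence)
        show "AE \<omega> in M. (\<lambda>n. indicator (Osc n) \<omega> :: real) \<longlonglongrightarrow> 0"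
        proof (rule AE_I2)
          fix \<omega> assume \<omega>: "\<omega> \<in> space M"
          have "uniformly_continuous_on {u..u + Suc m} (\<lambda>v. X v \<omega>)"
            using u by (intro compact_uniformly_continuous continuous_on_subset[OF continuous_X[OF \<omega>]]) auto
          then obtain \<delta> where \<delta>: "\<delta> > 0" "\<And>s t. s \<in> {u..u + Suc m} \<Longrightarrow> t \<in> {u..u + Suc m} \<Longrightarrow> \<bar>t - s\<bar> < \<delta> \<Longrightarrow> \<bar>X t \<omega> - X s \<omega>\<bar> < \<eta>"
            unfolding uniformly_continuous_on_def dist_real_def using \<open>\<eta> > 0\<close> by meson
          obtain n0 where n0: "1 / Suc n0 < \<delta>" using \<delta>(1) nat_approx_posE by blast
          have "\<omega> \<notin> Osc n" if "n \<ge> n0" for n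
          proof -
            have "1 / real (Suc n) \<le> 1 / Suc n0" using that by (intro divide_left_mono) auto
            then have d: "1 / real (Suc n) < \<delta>" using n0 by simp
            have "\<bar>X (u + real (Suc k) * (1 / Suc n)) \<omega> - X (u + real k * (1 / Suc n)) \<omega>\<bar> \<le> \<eta>" if k: "k < Suc m * Suc n" for k
            proof -
              have kk: "real j * (1 / Suc n) \<le> Suc m" if "j \<le> Suc m * Suc n" for j
              proof -
                have "real j \<le> real (Suc m * Suc n)" using that by (simp only: of_nat_le_iff)
                then show ?thesis by (simp add: field_simps)
              qed
              have "\<bar>(u + real (Suc k) * (1 / Suc n)) - (u + real k * (1 / Suc n))\<bar> < \<delta>"
                using d by (simp add: field_simps)
              then show ?thesis using kk[of k] kk[of "Suc k"] k by (intro less_imp_le \<delta>(2)) auto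
            qed
            then show ?thesis by (auto simp: Osc_def)
          qed
          then show "(\<lambda>n. indicator (Osc n) \<omega> :: real) \<longlonglongrightarrow> 0"
            by (intro tendsto_eventually eventually_sequentiallyI[of n0]) simp
        qed
      qed (auto simp: indicator_def)
      then show ?thesis by simp
    qed
    then have "(\<lambda>n. ennreal (exp (2 * lam * \<eta>) * ?pH + K * prob (Osc n) + 1 / Suc m + exp (lam * z - lam\<^sup>2 / 2 * (u + Suc m))))
       \<longlonglongrightarrow> ennreal (exp (2 * lam * \<eta>) * ?pH + K * 0 + 1 / Suc m + exp (lam * z - lam\<^sup>2 / 2 * (u + Suc m)))"
      by (intro tendsto_intros)
    then have "?R \<le> ennreal (exp (2 * lam * \<eta>) * ?pH + K * 0 + 1 / Suc m + exp (lam * z - lam\<^sup>2 / 2 * (u + Suc m)))"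
      by (rule LIMSEQ_le_const) (use bound in blast)
    then show ?thesis by (simp only: mult_zero_right add_0_right)
  qed
  have all: "?R \<le> ennreal (exp (2 * lam * \<eta>) * ?pH)" if "\<eta> > 0" for \<eta>
  proof (rule LIMSEQ_le_const)
    have "(\<lambda>m. exp (lam * z - lam\<^sup>2 / 2 * (u + Suc m))) \<longlonglongrightarrow> 0"
      using lam_pos by real_asymp
    then have "(\<lambda>m. ennreal (exp (2 * lam * \<eta>) * ?pH + 1 / Suc m + exp (lam * z - lam\<^sup>2 / 2 * (u + Suc m)))) \<longlonglongrightarrow> ennreal (exp (2 * lam * \<eta>) * ?pH + 0 + 0)"
      using LIMSEQ_inverse_real_of_nat unfolding inverse_eq_divide
      by (intro tendsto_ennrealI tendsto_add tendsto_const)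
    then show "(\<lambda>m. ennreal (exp (2 * lam * \<eta>) * ?pH + 1 / Suc m + exp (lam * z - lam\<^sup>2 / 2 * (u + Suc m)))) \<longlonglongrightarrow> ennreal (exp (2 * lam * \<eta>) * ?pH)"
      by (simp only: add_0_right)
  qed (use step[OF that] in blast)
  have "?R \<le> ennreal (exp (2 * lam * 0) * ?pH)"
  proof (rule LIMSEQ_le_const)
    have "?R \<le> ennreal (exp (2 * lam * (1 / Suc n)) * ?pH)" for n by (rule all) simp
    then show "\<exists>N. \<forall>n\<ge>N. ?R \<le> ennreal (exp (2 * lam * (1 / Suc n)) * ?pH)" by blast
    show "(\<lambda>n. ennreal (exp (2 * lam * (1 / Suc n)) * ?pH)) \<longlonglongrightarrow> ennreal (exp (2 * lam * 0) * ?pH)"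
      using LIMSEQ_inverse_real_of_nat unfolding inverse_eq_divide by (intro tendsto_intros)
  qed
  then show ?thesis by (simp add: emeasure_eq_measure)
qed

section \<open>The hitting probability from an arbitrary state\<close>

lemma exp_bound_tendsto_0: "(\<lambda>n. exp (lam * z - lam\<^sup>2 / 2 * (u + real n))) \<longlonglongrightarrow> 0"
  using lam_pos by real_asymp

text \<open>A Chernoff bound with exponent \<open>lam\<close>.\<close>

lemma prob_X_less:
  assumes "t > 0" shows "prob {\<omega>\<in>space M. X t \<omega> < z} \<le> exp (lam * z - lam\<^sup>2 / 2 * t)"
proof -
  have [measurable]: "X t \<in> borel_measurable M" using assms by simp
  have "emeasure M {\<omega>\<in>space M. X t \<omega> < z} = (\<integral>\<^sup>+ \<omega>. indicator {\<omega>\<in>space M. X t \<omega> < z} \<omega> \<partial>M)" by simp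
  also have "\<dots> \<le> (\<integral>\<^sup>+ \<omega>. ennreal (exp (lam * (z - X t \<omega>))) \<partial>M)"
    using lam_pos by (intro nn_integral_mono) (auto simp: indicator_def ennreal_ge_1)
  finally show ?thesis using assms by (simp add: nn_integral_exp_X emeasure_eq_measure)
qed

text \<open>By the Chernoff bound the path almost surely is not below \<open>z\<close> at all times
  \<open>u + Suc n\<close>; the intermediate value theorem yields the visit.\<close>

lemma hits_after_from_below:
  assumes u: "u \<ge> 0" shows "AE \<omega> in M. X u \<omega> < z \<longrightarrow> \<omega> \<in> hits_after u"
proof -
  let ?N = "{\<omega>\<in>space M. \<forall>n::nat. X (u + Suc n) \<omega> < z}"
  have [measurable]: "X (u + Suc n) \<in> borel_measurable M" for n using u by simp
  have "prob ?N \<le> exp (lam * z - lam\<^sup>2 / 2 * (u + real (Suc n)))" for n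
  proof -
    have "prob ?N \<le> prob {\<omega>\<in>space M. X (u + Suc n) \<omega> < z}"
      by (rule finite_measure_mono) (auto simp del: of_nat_Suc)
    also have "\<dots> \<le> exp (lam * z - lam\<^sup>2 / 2 * (u + Suc n))" using u by (intro prob_X_less) simp
    finally show ?thesis .
  qed
  moreover have "(\<lambda>n. exp (lam * z - lam\<^sup>2 / 2 * (u + real (Suc n)))) \<longlonglongrightarrow> 0"
    using LIMSEQ_Suc[OF exp_bound_tendsto_0] .
  ultimately have "prob ?N \<le> 0" by (intro LIMSEQ_le_const) blast+
  moreover have "?N \<in> events" by measurable
  ultimately have "AE \<omega> in M. \<omega> \<notin> ?N"
    by (intro AE_not_in null_setsI) (simp_all add: emeasure_eq_measure measure_le_0_iff)
  then show ?thesis using AE_space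
  proof eventually_elim
    case (elim \<omega>)
    note True = \<open>\<omega> \<in> space M\<close>
    show ?case
    proof
      assume less: "X u \<omega> < z"
      show "\<omega> \<in> hits_after u"
      proof -
        from elim obtain n where n: "X (u + Suc n) \<omega> \<ge> z" by (auto simp: not_less)
        have "\<exists>v\<ge>u. v \<le> u + Suc n \<and> X v \<omega> = z"
        proof (rule IVT')
          show "continuous_on {u..u + Suc n} (\<lambda>v. X v \<omega>)"
            using u by (intro continuous_on_subset[OF continuous_X[OF True]]) auto
        qed (use n less in auto)
        then obtain v where "v \<ge> u" "X v \<omega> = z" by auto
        moreover have "v \<noteq> u" using less calculation by auto
        ultimately show ?thesis using True by (auto simp: hits_after_def intro!: exI[of _ v])
      qed
    qed
  qed
qed

text \<open>Hides the exceptional state of the kernels at fixed times. Positive times have a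
  density; at time 0 the reason is that \<open>z\<close> differs from 0.\<close>

lemma AE_X_neq:
  assumes "u \<ge> 0" shows "AE \<omega> in M. X u \<omega> \<noteq> z"
proof (cases "u = 0")
  case True then show ?thesis using AE_X_0 z_pos by (auto elim!: eventually_mono)
next
  case False
  then have u: "0 < u" using assms by simp
  have "AE x in lborel. x \<noteq> z" by (rule AE_lborel_singleton)
  then have "AE \<omega> in M. X u \<omega> - X 0 \<omega> \<noteq> z"
    using distributed_AE2[OF distributed_increment[OF order_refl u], of "\<lambda>x. x \<noteq> z"] by (auto elim!: eventually_mono)
  with AE_X_0 show ?thesis by eventually_elim auto
qed

text \<open>Above \<open>z\<close> the two grid estimates meet, below \<open>z\<close> a later visit
  is almost sure, and the state \<open>z\<close> itself is negligible at time
  \<open>u\<close>.\<close>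

lemma emeasure_hits_after:
  assumes u: "u \<ge> 0" and A: "A \<in> sets (F u)"
  shows "emeasure M (A \<inter> hits_after u) = (\<integral>\<^sup>+ \<omega>. indicator A \<omega> * ennreal (hit_prob lam z (X u \<omega>)) \<partial>M)"
proof -
  have [measurable]: "X u \<in> borel_measurable M" "A \<in> events" using u A sets_F_events by auto
  let ?A1 = "{\<omega>\<in>A. X u \<omega> > z}" and ?A2 = "{\<omega>\<in>A. X u \<omega> < z}"
  have Asp: "A \<subseteq> space M" by (rule sets.sets_into_space) simp
  have eq1: "?A1 = A \<inter> {\<omega>\<in>space (F u). X u \<omega> > z}" and eq2: "?A2 = A \<inter> {\<omega>\<in>space M. X u \<omega> < z}" using Asp by auto
  have "{\<omega>\<in>space (F u). X u \<omega> > z} \<in> sets (F u)"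
    using measurable_X_F[OF u order_refl] unfolding borel_measurable_iff_greater by blast
  then have A1: "?A1 \<in> sets (F u)" unfolding eq1 using A by (intro sets.Int)
  have [measurable]: "?A1 \<in> events" using A1 by (rule sets_F_events)
  have [measurable]: "?A2 \<in> events" unfolding eq2 by measurable
  have "emeasure M (A \<inter> hits_after u) = emeasure M ((?A1 \<inter> hits_after u) \<union> ?A2)"
    using u
    by (intro emeasure_eq_AE, use AE_X_neq[OF u] hits_after_from_below[OF u] in eventually_elim) auto
  also have "\<dots> = emeasure M (?A1 \<inter> hits_after u) + emeasure M ?A2"
    using u by (intro plus_emeasure[symmetric]) auto
  also have "emeasure M (?A1 \<inter> hits_after u) = (\<integral>\<^sup>+ \<omega>. indicator ?A1 \<omega> * ennreal (exp (2 * lam * (z - X u \<omega>))) \<partial>M)"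
    using u A1 by (intro antisym hits_after_upper hits_after_lower) auto
  also have "emeasure M ?A2 = (\<integral>\<^sup>+ \<omega>. indicator ?A2 \<omega> \<partial>M)" by simp
  also have "(\<integral>\<^sup>+ \<omega>. indicator ?A1 \<omega> * ennreal (exp (2 * lam * (z - X u \<omega>))) \<partial>M) + \<dots>
     = (\<integral>\<^sup>+ \<omega>. indicator ?A1 \<omega> * ennreal (exp (2 * lam * (z - X u \<omega>))) + indicator ?A2 \<omega> \<partial>M)"
    by (rule nn_integral_add[symmetric]) measurable
  also have "\<dots> = (\<integral>\<^sup>+ \<omega>. indicator A \<omega> * ennreal (hit_prob lam z (X u \<omega>)) \<partial>M)"
    by (rule nn_integral_cong_AE, use AE_X_neq[OF u] in eventually_elim)
       (auto simp: indicator_def hit_prob_above hit_prob_below)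
  finally show ?thesis .
qed

text \<open>The mean of \<open>hit_prob\<close> at integer times is dominated by that of the
  exponential with exponent \<open>lam\<close>, which tends to 0. This is the almost sure finiteness
  of the last passage time.\<close>

lemma AE_not_hits_after: "AE \<omega> in M. \<exists>n::nat. \<omega> \<notin> hits_after (real n)"
proof -
  let ?N = "{\<omega>\<in>space M. \<forall>n::nat. \<omega> \<in> hits_after (real n)}"
  have [measurable]: "hits_after (real n) \<in> events" for n by (rule sets_hits_after) simp
  have "prob ?N \<le> exp (lam * z - lam\<^sup>2 / 2 * (0 + real (Suc n)))" for n
  proof -
    have "emeasure M (hits_after (Suc n)) = emeasure M (space M \<inter> hits_after (Suc n))"
      using sets.sets_into_space[OF sets_hits_after, of "Suc n"] by (simp add: Int_absorb1)
    also have "\<dots> = (\<integral>\<^sup>+ \<omega>. indicator (space M) \<omega> * ennreal (hit_prob lam z (X (Suc n) \<omega>)) \<partial>M)"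
      by (rule emeasure_hits_after) (use sets.top[of "F (Suc n)"] in auto)
    also have "\<dots> \<le> (\<integral>\<^sup>+ \<omega>. ennreal (exp (lam * (z - X (Suc n) \<omega>))) \<partial>M)"
      using lam_pos by (intro nn_integral_mono) (auto simp: indicator_def intro!: ennreal_leI hit_prob_le_exp)
    also have "\<dots> = ennreal (exp (lam * z - lam\<^sup>2 / 2 * (Suc n)))" by (rule nn_integral_exp_X) simp
    finally have "prob (hits_after (Suc n)) \<le> exp (lam * z - lam\<^sup>2 / 2 * (0 + real (Suc n)))"
      by (simp add: emeasure_eq_measure)
    moreover have "prob ?N \<le> prob (hits_after (Suc n))"
      by (rule finite_measure_mono) (auto simp del: of_nat_Suc)
    ultimately show ?thesis by simp
  qed
  moreover have "(\<lambda>n. exp (lam * z - lam\<^sup>2 / 2 * (0 + real (Suc n)))) \<longlonglongrightarrow> 0"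
    using LIMSEQ_Suc[OF exp_bound_tendsto_0] .
  ultimately have "prob ?N \<le> 0" by (intro LIMSEQ_le_const) blast+
  moreover have "?N \<in> events" by measurable
  ultimately have "AE \<omega> in M. \<omega> \<notin> ?N"
    by (intro AE_not_in null_setsI) (simp_all add: emeasure_eq_measure measure_le_0_iff)
  then show ?thesis by eventually_elim (auto simp: hits_after_def)
qed

section \<open>The Markov property\<close>

abbreviation "\<xi> \<equiv> stopped_process B lam z"
abbreviation "\<sigma> \<equiv> last_passage B lam z"

text \<open>A supremum exceeds \<open>u\<close> strictly iff some element does, whether or not it is
  attained.\<close>

lemma less_last_passage_iff:
  assumes "u \<ge> 0" "\<omega> \<in> space M"
  shows "ennreal u < \<sigma> \<omega> \<longleftrightarrow> \<omega> \<in> hits_after u"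
proof
  assume "ennreal u < \<sigma> \<omega>"
  then show "\<omega> \<in> hits_after u"
    using assms unfolding last_passage_def less_Sup_iff hits_after_def by (auto simp: ennreal_less_iff)
next
  assume "\<omega> \<in> hits_after u"
  then obtain v where v: "v > u" "X v \<omega> = z" by (auto simp: hits_after_def)
  then have "ennreal v \<in> {ennreal t |t. t > 0 \<and> X t \<omega> = z}" using assms(1) by auto
  moreover have "ennreal u < ennreal v" using v assms(1) by (simp add: ennreal_less_iff)
  ultimately show "ennreal u < \<sigma> \<omega>" unfolding last_passage_def less_Sup_iff by blast
qed

lemma borel_measurable_last_passage [measurable]: "\<sigma> \<in> borel_measurable M"
proof (rule borel_measurableI_greater)
  fix y :: ennreal
  show "{\<omega>\<in>space M. y < \<sigma> \<omega>} \<in> events"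
  proof (cases y)
    case (real r)
    then have "{\<omega>\<in>space M. y < \<sigma> \<omega>} = hits_after r"
      using less_last_passage_iff[of r] by (auto simp: hits_after_def)
    with real show ?thesis by simp
  qed simp
qed

lemma continuous_stopped:
  assumes "\<omega> \<in> space M" shows "continuous_on {0..} (\<lambda>t. \<xi> t \<omega>)"
proof -
  have *: "continuous_on {0..} (\<lambda>t. enn2real (min (ennreal t) (\<sigma> \<omega>)))"
  proof (cases "\<sigma> \<omega>")
    case (real r)
    then have "continuous_on {0..} (\<lambda>t. enn2real (min (ennreal t) (\<sigma> \<omega>))) = continuous_on {0..} (\<lambda>t. min t r)"
      by (intro continuous_on_cong) (auto simp: min_def)
    then show ?thesis by (auto intro!: continuous_intros)
  next
    case top
    then have "continuous_on {0..} (\<lambda>t. enn2real (min (ennreal t) (\<sigma> \<omega>))) = continuous_on {0..} (\<lambda>t::real. t)"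
      by (intro continuous_on_cong) (auto simp: min_def)
    then show ?thesis by (auto intro!: continuous_intros)
  qed
  show ?thesis
    unfolding stopped_process_def by (rule continuous_on_compose2[OF continuous_X[OF assms] *]) auto
qed

lemma measurable_stopped [measurable]: "\<xi> t \<in> borel_measurable M"
  unfolding stopped_process_def
  by (rule borel_measurable_random_time[where Y=X]) (auto intro: continuous_X)

lemma stopped_eq_X:
  assumes "u \<ge> 0" "\<omega> \<in> hits_after u" shows "\<xi> u \<omega> = X u \<omega>"
proof -
  have "ennreal u < \<sigma> \<omega>" using assms less_last_passage_iff[of u \<omega>] by (auto simp: hits_after_def)
  then show ?thesis using assms(1) by (simp add: stopped_process_def min_absorb1 less_imp_le)
qed

lemma AE_stopped_eq_level: "AE \<omega> in M. \<omega> \<in> hits_after 0 \<and> (\<forall>u\<ge>0. \<omega> \<notin> hits_after u \<longrightarrow> \<xi> u \<omega> = z)"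
  using AE_X_0 hits_after_from_below[OF order_refl] AE_not_hits_after
proof eventually_elim
  case (elim \<omega>)
  then have h0: "\<omega> \<in> hits_after 0" using z_pos by simp
  then have \<omega>: "\<omega> \<in> space M" by (simp add: hits_after_def)
  from h0 obtain t0 where t0: "t0 > 0" "X t0 \<omega> = z" by (auto simp: hits_after_def)
  obtain n :: nat where n: "\<omega> \<notin> hits_after (real n)" using elim by auto
  \<comment> \<open>Cutting off at a visit \<open>t0 > 0\<close> gives a closed set; visits at
    strictly positive times could accumulate at 0.\<close>
  define T where "T = {t\<in>{t0..}. X t \<omega> = z}"
  define r where "r = Sup T"
  have T: "t0 \<in> T" "bdd_above T" using t0 n \<omega> by (auto simp: T_def hits_after_def bdd_above_def not_less intro: exI[of _ "real n"])
  have "closed T" unfolding T_def using t0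
    by (intro continuous_closed_preimage_constant continuous_on_subset[OF continuous_X[OF \<omega>]]) auto
  then have rT: "r \<in> T" unfolding r_def using T by (intro closed_contains_Sup) auto
  then have r: "r \<ge> t0" "X r \<omega> = z" by (auto simp: T_def)
  have "\<sigma> \<omega> = ennreal r"
    unfolding last_passage_def
  proof (rule Sup_eqI)
    fix y assume "y \<in> {ennreal t |t. t > 0 \<and> X t \<omega> = z}"
    then obtain t where t: "y = ennreal t" "t > 0" "X t \<omega> = z" by auto
    have "t \<le> r"
    proof (cases "t0 \<le> t")
      case True
      then have "t \<in> T" using t by (simp add: T_def)
      then show ?thesis unfolding r_def using T(2) by (rule cSup_upper)
    qed (use r in simp)
    then show "y \<le> ennreal r" using t by (simp add: ennreal_leI)
  next
    fix y assume "\<And>x. x \<in> {ennreal t |t. t > 0 \<and> X t \<omega> = z} \<Longrightarrow> x \<le> y"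
    moreover have "ennreal r \<in> {ennreal t |t. t > 0 \<and> X t \<omega> = z}" using r t0 by auto
    ultimately show "ennreal r \<le> y" by blast
  qed
  then have "\<xi> u \<omega> = z" if "u \<ge> 0" "\<omega> \<notin> hits_after u" for u
    using that less_last_passage_iff[of u \<omega>] \<omega> r t0 by (auto simp: stopped_process_def not_less min_def)
  with h0 show ?case by auto
qed

lemma hits_after_antimono: "u \<le> v \<Longrightarrow> hits_after v \<subseteq> hits_after u"
  by (auto simp: hits_after_def intro: le_less_trans)

text \<open>When \<open>z\<close> is still to be visited after \<open>s\<close>, the stopped and the
  original path agree up to \<open>s\<close>, so the generators have the same trace; complements and
  countable unions preserve this. It carries the problem from the past of \<open>\<xi>\<close> to
  \<open>F s\<close>.\<close>

lemma natural_filtration_stopped_trace: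
  assumes s: "s \<ge> 0" and A: "A \<in> sets (natural_filtration M \<xi> (ennreal s))"
  shows "\<exists>A'\<in>sets (F s). A \<inter> hits_after s = A' \<inter> hits_after s"
  using A unfolding sets_natural_filtration[of M \<xi>]
proof (induction rule: sigma_sets.induct)
  case (Basic A)
  then obtain u C where u: "0 \<le> u" "ennreal u \<le> ennreal s" and C: "C \<in> sets borel" and A: "A = \<xi> u -` C \<inter> space M" by auto
  have "u \<le> s" using u s by simp
  have "X u -` C \<inter> space (F s) \<in> sets (F s)"
    using measurable_X_F[OF u(1) \<open>u \<le> s\<close>] C by (rule measurable_sets)
  moreover have "A \<inter> hits_after s = (X u -` C \<inter> space (F s)) \<inter> hits_after s"
    using hits_after_antimono[OF \<open>u \<le> s\<close>] stopped_eq_X[OF u(1)] by (auto simp: A)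
  ultimately show ?case by blast
next
  case Empty
  then show ?case by (intro bexI[of _ "{}"]) auto
next
  case (Compl A)
  then obtain A' where A': "A' \<in> sets (F s)" "A \<inter> hits_after s = A' \<inter> hits_after s" by blast
  have "space (F s) - A' \<in> sets (F s)" using A'(1) by (rule sets.compl_sets)
  moreover have "(space M - A) \<inter> hits_after s = (space (F s) - A') \<inter> hits_after s" using A'(2) by auto
  ultimately show ?case by blast
next
  case (Union A)
  then obtain A' where A': "\<And>i. A' i \<in> sets (F s)" "\<And>i. A i \<inter> hits_after s = A' i \<inter> hits_after s" by metis
  have "(\<Union>i. A' i) \<in> sets (F s)" using A'(1) by (intro sets.countable_UN) auto
  moreover have "(\<Union>i. A i) \<inter> hits_after s = (\<Union>i. A' i) \<inter> hits_after s" using A'(2) by blast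
  ultimately show ?case by blast
qed

lemma sigma_finite_subalgebra_natural:
  assumes "subalgebra M G" shows "sigma_finite_subalgebra M G"
proof -
  interpret finite_measure_subalgebra M G by standard (rule assms)
  show ?thesis by unfold_locales
qed

text \<open>By uniqueness of conditional expectations, \<open>emeasure_hits_after\<close> extends
  from events to nonnegative weights that depend on the past.\<close>

lemma nn_integral_hits_after:
  assumes u: "u \<ge> 0" and Y: "Y \<in> borel_measurable (F u)"
  shows "(\<integral>\<^sup>+ \<omega>. Y \<omega> * indicator (hits_after u) \<omega> \<partial>M) = (\<integral>\<^sup>+ \<omega>. Y \<omega> * ennreal (hit_prob lam z (X u \<omega>)) \<partial>M)"
proof -
  interpret sigma_finite_subalgebra M "F u" by (rule sigma_finite_subalgebra_natural[OF subalgebra_F])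
  have [measurable]: "X u \<in> borel_measurable (F u)" using u by (intro measurable_X_F) auto
  have [measurable]: "hits_after u \<in> events" using u by (rule sets_hits_after)
  have "AE \<omega> in M. ennreal (hit_prob lam z (X u \<omega>)) = nn_cond_exp M (F u) (indicator (hits_after u)) \<omega>"
  proof (rule nn_cond_exp_charact)
    fix A assume A: "A \<in> sets (F u)"
    then have "A \<in> events" by (rule sets_F_events)
    then have "(\<integral>\<^sup>+ \<omega>\<in>A. indicator (hits_after u) \<omega> \<partial>M) = emeasure M (A \<inter> hits_after u)"
      by (simp add: nn_integral_indicator[symmetric] indicator_inter_arith mult.commute del: nn_integral_indicator)
    then show "(\<integral>\<^sup>+ \<omega>\<in>A. indicator (hits_after u) \<omega> \<partial>M) = (\<integral>\<^sup>+ \<omega>\<in>A. ennreal (hit_prob lam z (X u \<omega>)) \<partial>M)"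
      using emeasure_hits_after[OF u A] by (simp add: mult.commute)
  qed measurable
  then have "(\<integral>\<^sup>+ \<omega>. Y \<omega> * ennreal (hit_prob lam z (X u \<omega>)) \<partial>M) = (\<integral>\<^sup>+ \<omega>. Y \<omega> * nn_cond_exp M (F u) (indicator (hits_after u)) \<omega> \<partial>M)"
    by (intro nn_integral_cong_AE) (auto elim!: eventually_mono)
  also have "\<dots> = (\<integral>\<^sup>+ \<omega>. Y \<omega> * indicator (hits_after u) \<omega> \<partial>M)"
    by (rule nn_cond_exp_intg) (use Y in auto)
  finally show ?thesis ..
qed

lemma nn_integral_X_transition:
  assumes s: "s \<ge> 0" and t: "t > 0" and Y[measurable]: "Y \<in> borel_measurable (F s)" and g[measurable]: "g \<in> borel_measurable borel"
  shows "(\<integral>\<^sup>+ \<omega>. Y \<omega> * g (X (s + t) \<omega>) \<partial>M)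
     = (\<integral>\<^sup>+ \<omega>. Y \<omega> * (\<integral>\<^sup>+ y. ennreal (normal_density (X s \<omega> + lam * t) (sqrt t) y) * g y \<partial>lborel) \<partial>M)"
proof -
  have [measurable]: "X s \<in> borel_measurable (F s)" using s by (intro measurable_X_F) auto
  have "(\<lambda>p. fst (fst p) * g (snd (fst p) + snd p)) \<in> borel_measurable (((borel :: ennreal measure) \<Otimes>\<^sub>M (borel :: real measure)) \<Otimes>\<^sub>M (borel :: real measure))"
    by measurable
  then have "(\<integral>\<^sup>+ \<omega>. Y \<omega> * g (X (s + t) \<omega>) \<partial>M)
      = (\<integral>\<^sup>+ \<omega>. (\<integral>\<^sup>+ r. ennreal (normal_density (lam * t) (sqrt t) r) * (Y \<omega> * g (X s \<omega> + r)) \<partial>lborel) \<partial>M)"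
    using nn_integral_past_increment[of s "s + t" "\<lambda>\<omega>. (Y \<omega>, X s \<omega>)" "borel \<Otimes>\<^sub>M borel" "\<lambda>p. fst (fst p) * g (snd (fst p) + snd p)"] s t
    by simp
  also have "\<dots> = (\<integral>\<^sup>+ \<omega>. Y \<omega> * (\<integral>\<^sup>+ y. ennreal (normal_density (X s \<omega> + lam * t) (sqrt t) y) * g y \<partial>lborel) \<partial>M)"
  proof (rule nn_integral_cong)
    fix \<omega>
    have "(\<integral>\<^sup>+ y. ennreal (normal_density (X s \<omega> + lam * t) (sqrt t) y) * g y \<partial>lborel)
        = (\<integral>\<^sup>+ r. ennreal (normal_density (X s \<omega> + lam * t) (sqrt t) (X s \<omega> + r)) * g (X s \<omega> + r) \<partial>lborel)"
      using nn_integral_real_affine[of "\<lambda>y. ennreal (normal_density (X s \<omega> + lam * t) (sqrt t) y) * g y" 1 "X s \<omega>"] by simp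
    also have "\<dots> = (\<integral>\<^sup>+ r. ennreal (normal_density (lam * t) (sqrt t) r) * g (X s \<omega> + r) \<partial>lborel)"
      by (simp add: normal_density_def)
    finally show "(\<integral>\<^sup>+ r. ennreal (normal_density (lam * t) (sqrt t) r) * (Y \<omega> * g (X s \<omega> + r)) \<partial>lborel)
        = Y \<omega> * (\<integral>\<^sup>+ y. ennreal (normal_density (X s \<omega> + lam * t) (sqrt t) y) * g y \<partial>lborel)"
      by (simp add: nn_integral_cmult[symmetric] ac_simps)
  qed
  finally show ?thesis .
qed

text \<open>The difference of two hitting probabilities: \<open>hit_prob\<close> at time
  \<open>s\<close>, and its mean after a further time \<open>t\<close>, which is smaller by the
  factor \<open>1 - q_fun\<close>.\<close>

lemma emeasure_absorbed_between:
  assumes s: "s \<ge> 0" and t: "t > 0" and A: "A \<in> sets (F s)"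
  shows "emeasure M (A \<inter> (hits_after s - hits_after (s + t)))
     = (\<integral>\<^sup>+ \<omega>. indicator A \<omega> * ennreal (hit_prob lam z (X s \<omega>) * q_fun lam z t (X s \<omega>)) \<partial>M)" (is "?a = ?a'")
proof -
  have [measurable]: "A \<in> events" "X s \<in> borel_measurable M" using A s sets_F_events by auto
  have st: "s + t \<ge> 0" "s \<le> s + t" using s t by auto
  have At: "A \<in> sets (F (s + t))" using st(2) A by (rule sets_F_mono)
  have [measurable]: "hits_after s \<in> events" "hits_after (s + t) \<in> events" using s st(1) by (auto intro: sets_hits_after)
  let ?b = "emeasure M (A \<inter> hits_after (s + t))"
  have "?b = (\<integral>\<^sup>+ \<omega>. indicator A \<omega> * ennreal (hit_prob lam z (X (s + t) \<omega>)) \<partial>M)"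
    by (rule emeasure_hits_after[OF st(1) At])
  also have "\<dots> = (\<integral>\<^sup>+ \<omega>. indicator A \<omega> * ennreal (hit_prob lam z (X s \<omega>) * (1 - q_fun lam z t (X s \<omega>))) \<partial>M)"
    using A by (subst nn_integral_X_transition[OF s t]) (simp_all add: nn_integral_normal_hit_prob[OF t] flip: ennreal_mult')
  finally have b: "?b = \<dots>" .
  \<comment> \<open>Adding \<open>?b\<close> avoids a subtraction in \<open>ennreal\<close>; being
    finite, it cancels at the end.\<close>
  have "?a + ?b = emeasure M (A \<inter> hits_after s)"
    using hits_after_antimono[OF st(2)] by (subst plus_emeasure) (auto intro!: arg_cong[where f="emeasure M"])
  also have "\<dots> = (\<integral>\<^sup>+ \<omega>. indicator A \<omega> * ennreal (hit_prob lam z (X s \<omega>)) \<partial>M)"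
    by (rule emeasure_hits_after[OF s A])
  also have "\<dots> = (\<integral>\<^sup>+ \<omega>. indicator A \<omega> * ennreal (hit_prob lam z (X s \<omega>) * q_fun lam z t (X s \<omega>))
       + indicator A \<omega> * ennreal (hit_prob lam z (X s \<omega>) * (1 - q_fun lam z t (X s \<omega>))) \<partial>M)"
  proof (rule nn_integral_cong)
    fix \<omega>
    have "hit_prob lam z (X s \<omega>) = hit_prob lam z (X s \<omega>) * q_fun lam z t (X s \<omega>) + hit_prob lam z (X s \<omega>) * (1 - q_fun lam z t (X s \<omega>))"
      by (simp add: algebra_simps)
    moreover have "0 \<le> hit_prob lam z (X s \<omega>) * q_fun lam z t (X s \<omega>)" "0 \<le> hit_prob lam z (X s \<omega>) * (1 - q_fun lam z t (X s \<omega>))"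
      using q_fun_bounds[of t lam z "X s \<omega>"] t lam_pos by auto
    ultimately show "indicator A \<omega> * ennreal (hit_prob lam z (X s \<omega>)) = indicator A \<omega> * ennreal (hit_prob lam z (X s \<omega>) * q_fun lam z t (X s \<omega>))
       + indicator A \<omega> * ennreal (hit_prob lam z (X s \<omega>) * (1 - q_fun lam z t (X s \<omega>)))"
      by (metis distrib_left ennreal_plus)
  qed
  also have "\<dots> = ?a' + ?b"
    unfolding b by (rule nn_integral_add) auto
  finally show ?thesis
    by (simp add: ennreal_add_left_cancel add.commute[of _ "emeasure M (A \<inter> hits_after (s + t))"])
qed

text \<open>\<open>A\<close> is split by whether \<open>z\<close> is visited after \<open>s\<close>.
  If not, both states are \<open>z\<close>, which the kernel preserves. If so, \<open>A\<close> may
  be exchanged for an event of \<open>F s\<close>, and a second split by visits after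
  \<open>s + t\<close> produces the Gaussian part and the atom of the kernel.\<close>

lemma nn_integral_stopped_transition:
  fixes f :: "real \<Rightarrow> ennreal"
  assumes s: "s \<ge> 0" and t: "t \<ge> 0" and A: "A \<in> sets (natural_filtration M \<xi> (ennreal s))" and f[measurable]: "f \<in> borel_measurable borel"
  shows "(\<integral>\<^sup>+ \<omega>. indicator A \<omega> * f (\<xi> (s + t) \<omega>) \<partial>M)
     = (\<integral>\<^sup>+ \<omega>. indicator A \<omega> * (\<integral>\<^sup>+ y. f y \<partial>trans_kernel lam z t (\<xi> s \<omega>)) \<partial>M)"
proof (cases "t = 0")
  case True then show ?thesis by (simp add: nn_integral_trans_kernel_0)
next
  case False
  then have t: "t > 0" using t by simp
  define P where "P x = (\<integral>\<^sup>+ y. f y \<partial>trans_kernel lam z t x)" for x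
  have [measurable]: "P \<in> borel_measurable borel"
    unfolding P_def[abs_def] using t by (intro measurable_nn_integral_trans_kernel) auto
  have Pz: "P z = f z" unfolding P_def using t by (rule nn_integral_trans_kernel_absorbed) simp
  have "A \<in> events"
    using A subalgebra_natural_filtration[of \<xi> M "ennreal s"] by (auto simp: subalgebra_def)
  note [measurable] = this
  from natural_filtration_stopped_trace[OF s A] obtain A' where A': "A' \<in> sets (F s)"
    and AA': "A \<inter> hits_after s = A' \<inter> hits_after s" by blast
  have st: "s + t \<ge> 0" "s \<le> s + t" using s t by auto
  have At: "A' \<in> sets (F (s + t))" using st(2) A' by (rule sets_F_mono)
  have [measurable]: "A' \<in> events" using A' by (rule sets_F_events)
  have G [measurable]: "hits_after s \<in> events" "hits_after (s + t) \<in> events" using s st(1) by (auto intro: sets_hits_after)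
  have [measurable]: "X s \<in> borel_measurable M" "X (s + t) \<in> borel_measurable M" using s st by auto
  have Xm: "X s \<in> borel_measurable (F s)" "X (s + t) \<in> borel_measurable (F (s + t))" by (rule measurable_X_F[OF s order_refl], rule measurable_X_F[OF st(1) order_refl])
  have ind: "(indicator A \<omega> :: ennreal) = indicator (A - hits_after s) \<omega> + indicator (A' \<inter> hits_after s) \<omega>" for \<omega>
    using AA' by (auto simp: indicator_def)
  let ?N = "\<lambda>x. \<integral>\<^sup>+ y. ennreal (normal_density (x + lam * t) (sqrt t) y * hit_prob lam z y) * f y \<partial>lborel"
  have *: "(\<integral>\<^sup>+ \<omega>. indicator (A' \<inter> hits_after s) \<omega> * f (\<xi> (s + t) \<omega>) \<partial>M) = (\<integral>\<^sup>+ \<omega>. indicator (A' \<inter> hits_after s) \<omega> * P (\<xi> s \<omega>) \<partial>M)"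
  proof -
    have "(\<integral>\<^sup>+ \<omega>. indicator (A' \<inter> hits_after s) \<omega> * f (\<xi> (s + t) \<omega>) \<partial>M)
       = (\<integral>\<^sup>+ \<omega>. (indicator A' \<omega> * f (X (s + t) \<omega>)) * indicator (hits_after (s + t)) \<omega>
            + f z * indicator (A' \<inter> (hits_after s - hits_after (s + t))) \<omega> \<partial>M)"
    proof (rule nn_integral_cong_AE, use AE_stopped_eq_level in eventually_elim)
      case (elim \<omega>)
      then show ?case
        using stopped_eq_X[OF st(1), of \<omega>] hits_after_antimono[OF st(2)] st(1)
        by (cases "\<omega> \<in> hits_after (s + t)") (auto simp: indicator_def)
    qed
    also have "\<dots> = (\<integral>\<^sup>+ \<omega>. (indicator A' \<omega> * f (X (s + t) \<omega>)) * indicator (hits_after (s + t)) \<omega> \<partial>M)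
            + f z * emeasure M (A' \<inter> (hits_after s - hits_after (s + t)))"
      by (subst nn_integral_add) (auto simp: nn_integral_cmult)
    \<comment> \<open>A visit after \<open>s + t\<close> is replaced by its conditional probability
      given \<open>F (s + t)\<close>; only then is the Gaussian transition from \<open>s\<close>
      applied.\<close>
    also have "(\<integral>\<^sup>+ \<omega>. (indicator A' \<omega> * f (X (s + t) \<omega>)) * indicator (hits_after (s + t)) \<omega> \<partial>M)
        = (\<integral>\<^sup>+ \<omega>. (indicator A' \<omega> * f (X (s + t) \<omega>)) * ennreal (hit_prob lam z (X (s + t) \<omega>)) \<partial>M)"
      by (intro nn_integral_hits_after[OF st(1)] borel_measurable_times_ennreal borel_measurable_indicator At
          measurable_compose[OF Xm(2) f])
    also have "\<dots> = (\<integral>\<^sup>+ \<omega>. indicator A' \<omega> * (ennreal (hit_prob lam z (X (s + t) \<omega>)) * f (X (s + t) \<omega>)) \<partial>M)"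
      by (simp add: ac_simps)
    also have "\<dots> = (\<integral>\<^sup>+ \<omega>. indicator A' \<omega> * ?N (X s \<omega>) \<partial>M)"
      using A' by (subst nn_integral_X_transition[OF s t]) (auto simp: ennreal_mult' mult.assoc)
    also have "f z * emeasure M (A' \<inter> (hits_after s - hits_after (s + t)))
        = (\<integral>\<^sup>+ \<omega>. f z * (indicator A' \<omega> * ennreal (hit_prob lam z (X s \<omega>) * q_fun lam z t (X s \<omega>))) \<partial>M)"
      by (subst emeasure_absorbed_between[OF s t A']) (simp add: nn_integral_cmult)
    also have "(\<integral>\<^sup>+ \<omega>. indicator A' \<omega> * ?N (X s \<omega>) \<partial>M) + \<dots>
        = (\<integral>\<^sup>+ \<omega>. indicator A' \<omega> * ?N (X s \<omega>) + f z * (indicator A' \<omega> * ennreal (hit_prob lam z (X s \<omega>) * q_fun lam z t (X s \<omega>))) \<partial>M)"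
      by (rule nn_integral_add[symmetric]) measurable
    \<comment> \<open>Both terms together are the kernel integral weighted by
      \<open>hit_prob\<close>, as \<open>X s\<close> almost surely avoids \<open>z\<close>. The
      weight is next turned back into the indicator of a visit after \<open>s\<close>.\<close>
    also have "\<dots> = (\<integral>\<^sup>+ \<omega>. (indicator A' \<omega> * P (X s \<omega>)) * ennreal (hit_prob lam z (X s \<omega>)) \<partial>M)"
    proof (rule nn_integral_cong_AE, use AE_X_neq[OF s] in eventually_elim)
      case (elim \<omega>)
      then show ?case
        using hit_prob_nn_integral_trans_kernel[OF t elim f, of lam] by (simp add: P_def[symmetric] distrib_left ac_simps)
    qed
    also have "\<dots> = (\<integral>\<^sup>+ \<omega>. (indicator A' \<omega> * P (X s \<omega>)) * indicator (hits_after s) \<omega> \<partial>M)"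
      by (intro nn_integral_hits_after[OF s, symmetric] borel_measurable_times_ennreal borel_measurable_indicator A'
          measurable_compose[OF Xm(1)]) simp
    also have "\<dots> = (\<integral>\<^sup>+ \<omega>. indicator (A' \<inter> hits_after s) \<omega> * P (\<xi> s \<omega>) \<partial>M)"
      using stopped_eq_X[OF s] by (intro nn_integral_cong) (auto simp: indicator_def)
    finally show ?thesis .
  qed
  have "(\<integral>\<^sup>+ \<omega>. indicator (A - hits_after s) \<omega> * f (\<xi> (s + t) \<omega>) \<partial>M) = (\<integral>\<^sup>+ \<omega>. indicator (A - hits_after s) \<omega> * P (\<xi> s \<omega>) \<partial>M)"
  proof (rule nn_integral_cong_AE, use AE_stopped_eq_level in eventually_elim)
    case (elim \<omega>)
    then show ?case
      using hits_after_antimono[OF st(2)] st(1) s Pz by (auto simp: indicator_def)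
  qed
  with * show ?thesis
    unfolding ind P_def[symmetric] distrib_right by (simp add: nn_integral_add)
qed

lemma markov_process_stopped: "markov_process M \<xi> (trans_kernel lam z)"
  unfolding markov_process_def
proof (intro conjI allI impI)
  fix t show "\<xi> t \<in> borel_measurable M" by simp
next
  show "transition_function (trans_kernel lam z)"
    using lam_pos by (intro transition_function_trans_kernel) simp
next
  fix s t :: real and f assume s: "s \<ge> 0" and t: "t \<ge> 0" and f: "bounded_measurable f"
  then obtain C where C: "\<And>x. \<bar>f x\<bar> \<le> C" and [measurable]: "f \<in> borel_measurable borel"
    by (auto simp: bounded_measurable_def)
  let ?F = "natural_filtration M \<xi> (ennreal s)" and ?P = "trans_kernel lam z t"
  have sub: "subalgebra M ?F" by (rule subalgebra_natural_filtration) simp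
  interpret S: sigma_finite_subalgebra M ?F by (rule sigma_finite_subalgebra_natural[OF sub])
  have [measurable]: "\<xi> s \<in> borel_measurable ?F" using s by (intro measurable_natural_filtration) auto
  \<comment> \<open>Shifting \<open>f\<close> by its bound gives a nonnegative function, to which
    the identity for nonnegative integrals applies.\<close>
  have bnd: "0 \<le> f x + C" "f x + C \<le> 2 * C" for x using C[of x] by auto
  define g where "g x = enn2real (\<integral>\<^sup>+ y. ennreal (f y + C) \<partial>?P x)" for x
  have pr: "prob_space (?P x)" for x using t lam_pos by (intro prob_space_trans_kernel) auto
  have fin: "(\<integral>\<^sup>+ y. ennreal (f y + C) \<partial>?P x) \<le> ennreal (2 * C)" for x
  proof -
    interpret P: prob_space "?P x" by (rule pr)
    have "(\<integral>\<^sup>+ y. ennreal (f y + C) \<partial>?P x) \<le> (\<integral>\<^sup>+ y. ennreal (2 * C) \<partial>?P x)"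
      using bnd(2) by (intro nn_integral_mono ennreal_leI)
    then show ?thesis by (simp add: P.emeasure_space_1[simplified])
  qed
  have eg: "ennreal (g x) = (\<integral>\<^sup>+ y. ennreal (f y + C) \<partial>?P x)" for x
    unfolding g_def using fin[of x] by (intro ennreal_enn2real) (rule le_less_trans, assumption, simp)
  have gb: "0 \<le> g x" "g x \<le> 2 * C" for x
  proof -
    show "0 \<le> g x" by (simp add: g_def)
    show "g x \<le> 2 * C" using fin[of x] bnd[of x] unfolding eg[symmetric] by (subst (asm) ennreal_le_iff) auto
  qed
  have [measurable]: "g \<in> borel_measurable borel"
    unfolding g_def[abs_def] using t by (intro borel_measurable_enn2real measurable_nn_integral_trans_kernel) auto
  have integral_f: "(\<integral>y. f y \<partial>?P x) = g x - C" for x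
  proof -
    interpret P: prob_space "?P x" by (rule pr)
    have [measurable_cong]: "sets (?P x) = sets borel" by simp
    have int: "integrable (?P x) f" using C by (intro P.integrable_const_bound[of _ C]) auto
    have "(\<integral>y. f y + C \<partial>?P x) = g x"
      unfolding g_def using bnd by (intro integral_eq_nn_integral) auto
    then show ?thesis using int by (simp add: P.prob_space[simplified])
  qed
  show "AE \<omega> in M. real_cond_exp M ?F (\<lambda>\<omega>. f (\<xi> (s + t) \<omega>)) \<omega> = (\<integral>y. f y \<partial>?P (\<xi> s \<omega>))"
    unfolding integral_f
  proof (rule S.real_cond_exp_charact)
    show i1: "integrable M (\<lambda>\<omega>. f (\<xi> (s + t) \<omega>))"
      using C by (intro integrable_const_bound[of _ C]) auto
    have ig: "integrable M (\<lambda>\<omega>. g (\<xi> s \<omega>))"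
      using gb by (intro integrable_const_bound[of _ "2 * C"]) auto
    then show i2: "integrable M (\<lambda>\<omega>. g (\<xi> s \<omega>) - C)" by auto
    fix A assume A: "A \<in> sets ?F"
    then have [measurable]: "A \<in> events" using sub by (auto simp: subalgebra_def)
    have "(\<integral>\<omega>. indicator A \<omega> * (f (\<xi> (s + t) \<omega>) + C) \<partial>M) = enn2real (\<integral>\<^sup>+ \<omega>. ennreal (indicator A \<omega> * (f (\<xi> (s + t) \<omega>) + C)) \<partial>M)"
      using bnd by (intro integral_eq_nn_integral) auto
    also have "(\<integral>\<^sup>+ \<omega>. ennreal (indicator A \<omega> * (f (\<xi> (s + t) \<omega>) + C)) \<partial>M) = (\<integral>\<^sup>+ \<omega>. indicator A \<omega> * ennreal (f (\<xi> (s + t) \<omega>) + C) \<partial>M)"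
      by (intro nn_integral_cong) (auto simp: indicator_def)
    also have "\<dots> = (\<integral>\<^sup>+ \<omega>. indicator A \<omega> * ennreal (g (\<xi> s \<omega>)) \<partial>M)"
      unfolding eg using nn_integral_stopped_transition[OF s t A, of "\<lambda>y. ennreal (f y + C)"] by simp
    also have "\<dots> = (\<integral>\<^sup>+ \<omega>. ennreal (indicator A \<omega> * g (\<xi> s \<omega>)) \<partial>M)"
      by (intro nn_integral_cong) (auto simp: indicator_def)
    also have "enn2real \<dots> = (\<integral>\<omega>. indicator A \<omega> * g (\<xi> s \<omega>) \<partial>M)"
      using gb by (intro integral_eq_nn_integral[symmetric]) auto
    finally have eq: "(\<integral>\<omega>. indicator A \<omega> * (f (\<xi> (s + t) \<omega>) + C) \<partial>M) = (\<integral>\<omega>. indicator A \<omega> * g (\<xi> s \<omega>) \<partial>M)" .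
    have "(\<integral>\<omega>. indicator A \<omega> * (f (\<xi> (s + t) \<omega>) + C) \<partial>M) = (\<integral>\<omega>. indicator A \<omega> * f (\<xi> (s + t) \<omega>) \<partial>M) + (\<integral>\<omega>. indicator A \<omega> * C \<partial>M)"
      using integrable_mult_indicator[OF \<open>A \<in> events\<close> i1] integrable_mult_indicator[OF \<open>A \<in> events\<close>, of "\<lambda>_. C"]
      by (subst Bochner_Integration.integral_add[symmetric]) (auto simp: distrib_left)
    moreover have "(\<integral>\<omega>. indicator A \<omega> * (g (\<xi> s \<omega>) - C) \<partial>M) = (\<integral>\<omega>. indicator A \<omega> * g (\<xi> s \<omega>) \<partial>M) - (\<integral>\<omega>. indicator A \<omega> * C \<partial>M)"
      using integrable_mult_indicator[OF \<open>A \<in> events\<close> ig] integrable_mult_indicator[OF \<open>A \<in> events\<close>, of "\<lambda>_. C"]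
      by (subst Bochner_Integration.integral_diff[symmetric]) (auto simp: right_diff_distrib)
    ultimately show "(\<integral>\<omega>\<in>A. f (\<xi> (s + t) \<omega>) \<partial>M) = (\<integral>\<omega>\<in>A. (g (\<xi> s \<omega>) - C) \<partial>M)"
      using eq by (simp add: set_lebesgue_integral_def)
  qed measurable
qed

section \<open>Failure of the strong Markov property\<close>

text \<open>Taken along \<open>\<xi>\<close> and not along the drifted motion, because the strong
  Markov property concerns stopping times of the filtration of \<open>\<xi>\<close>. The infimum of
  the empty set is infinite.\<close>

definition first_passage :: "'a \<Rightarrow> ennreal" where
  "first_passage \<omega> = Inf {ennreal t |t. t \<ge> 0 \<and> \<xi> t \<omega> = z}"

lemma first_passage_le: "t \<ge> 0 \<Longrightarrow> \<xi> t \<omega> = z \<Longrightarrow> first_passage \<omega> \<le> ennreal t"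
  unfolding first_passage_def by (rule Inf_lower) auto

lemma first_passage_attained:
  assumes \<omega>: "\<omega> \<in> space M" and fin: "first_passage \<omega> < \<infinity>"
  shows "\<exists>t\<ge>0. first_passage \<omega> = ennreal t \<and> \<xi> t \<omega> = z"
proof -
  define T where "T = {t\<in>{0..}. \<xi> t \<omega> = z}"
  have T: "first_passage \<omega> = Inf (ennreal ` T)"
    unfolding first_passage_def T_def by (intro arg_cong[where f=Inf]) auto
  have ne: "T \<noteq> {}" using fin unfolding T by (auto simp: infinity_ennreal_def)
  have bdd: "bdd_below T" by (auto simp: T_def bdd_below_def intro: exI[of _ 0])
  have "closed T"
    unfolding T_def by (intro continuous_closed_preimage_constant continuous_stopped[OF \<omega>]) auto
  with ne bdd have mem: "Inf T \<in> T" by (intro closed_contains_Inf)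
  have "first_passage \<omega> = ennreal (Inf T)"
    unfolding T using mem bdd by (intro Inf_eqI) (auto intro!: ennreal_leI cInf_lower)
  with mem show ?thesis by (auto simp: T_def)
qed

text \<open>Since the infimum is attained, passage by time \<open>c\<close> means that
  \<open>z\<close> occurs on a compact time interval ending in \<open>c\<close>, an event of the raw
  filtration at \<open>c\<close> itself.\<close>

lemma stopping_time_first_passage: "stopping_time (natural_filtration M \<xi>) first_passage"
proof
  fix c :: ennreal
  show "Measurable.pred (natural_filtration M \<xi> c) (\<lambda>\<omega>. first_passage \<omega> \<le> c)"
  proof (cases c)
    case (real r)
    have "{\<omega>\<in>space (natural_filtration M \<xi> c). \<exists>t\<in>{0..r}. \<xi> t \<omega> = z} \<in> sets (natural_filtration M \<xi> c)"
    proof (rule sets_attains_on_interval)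
      show "continuous_on {0..r} (\<lambda>t. \<xi> t \<omega>)" if "\<omega> \<in> space (natural_filtration M \<xi> c)" for \<omega>
        using that by (intro continuous_on_subset[OF continuous_stopped]) auto
      show "\<xi> t \<in> borel_measurable (natural_filtration M \<xi> c)" if "t \<in> {0..r}" for t
        using that real by (intro measurable_natural_filtration) (auto intro: ennreal_leI)
    qed
    also have "{\<omega>\<in>space (natural_filtration M \<xi> c). \<exists>t\<in>{0..r}. \<xi> t \<omega> = z}
        = {\<omega>\<in>space (natural_filtration M \<xi> c). first_passage \<omega> \<le> c}"
    proof (intro Collect_cong conj_cong refl iffI)
      fix \<omega> assume "\<exists>t\<in>{0..r}. \<xi> t \<omega> = z"
      then show "first_passage \<omega> \<le> c" using real first_passage_le by (force intro: order_trans ennreal_leI)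
    next
      fix \<omega> assume \<omega>: "\<omega> \<in> space (natural_filtration M \<xi> c)" and le: "first_passage \<omega> \<le> c"
      then have "first_passage \<omega> < \<infinity>" using real by (auto simp: infinity_ennreal_def intro: le_less_trans)
      with first_passage_attained \<omega> obtain t where "t \<ge> 0" "first_passage \<omega> = ennreal t" "\<xi> t \<omega> = z" by auto
      with le real show "\<exists>t\<in>{0..r}. \<xi> t \<omega> = z" by auto
    qed
    finally show ?thesis by (simp add: pred_def)
  qed simp
qed

lemma borel_measurable_first_passage [measurable]: "first_passage \<in> borel_measurable M"
  using stopping_time_first_passage
  by (rule measurable_stopping_time)
     (use subalgebra_natural_filtration[of \<xi> M] in \<open>auto simp: subalgebra_def\<close>)

lemma AE_first_passage_finite: "AE \<omega> in M. first_passage \<omega> < \<infinity>"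
  using AE_stopped_eq_level
proof eventually_elim
  case (elim \<omega>)
  then obtain v where v: "v > 0" "X v \<omega> = z" by (auto simp: hits_after_def)
  have "\<xi> v \<omega> = z"
    using elim v stopped_eq_X[of v \<omega>] by (cases "\<omega> \<in> hits_after v") auto
  then have "first_passage \<omega> \<le> ennreal v" using v by (intro first_passage_le) auto
  then show ?case by (rule le_less_trans) simp
qed

lemma measure_trans_kernel_absorbed: "t \<ge> 0 \<Longrightarrow> measure (trans_kernel lam z t z) {z} = 1"
  using nn_integral_trans_kernel_absorbed[of t "indicator {z}" lam z] nn_integral_trans_kernel_0[of "indicator {z}" lam z z]
  by (cases "t = 0") (simp_all add: measure_def)

lemma subalgebra_pre_sigma: "subalgebra M (filtration.pre_sigma (space M) (natural_filtration M \<xi>) first_passage)"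
proof -
  interpret filtration "space M" "natural_filtration M \<xi>" by (rule filtration_natural_filtration)
  show ?thesis
    unfolding subalgebra_def
  proof (intro conjI subsetI)
    fix A assume "A \<in> sets (pre_sigma first_passage)"
    then have "{\<omega>\<in>A. first_passage \<omega> \<le> top} \<in> sets (natural_filtration M \<xi> top)"
      by (rule sets_pre_sigmaD[OF stopping_time_first_passage])
    then show "A \<in> events"
      using subalgebra_natural_filtration[of \<xi> M top] by (auto simp: subalgebra_def)
  qed (simp add: space_pre_sigma)
qed

text \<open>The strong Markov property at the first passage time would make \<open>z\<close> absorbing from that time on.\<close>

lemma strong_markov_imp_absorbed:
  assumes sm: "strong_markov M \<xi> (trans_kernel lam z)" and q: "q \<ge> 0"
  shows "AE \<omega> in M. \<xi> (enn2real (first_passage \<omega>) + q) \<omega> = z"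
proof -
  let ?G = "filtration.pre_sigma (space M) (natural_filtration M \<xi>) first_passage"
  interpret S: sigma_finite_subalgebra M ?G by (rule sigma_finite_subalgebra_natural[OF subalgebra_pre_sigma])
  define \<phi> :: "'a \<Rightarrow> real" where
    "\<phi> \<omega> = (if first_passage \<omega> < \<infinity> then indicator {z} (\<xi> (enn2real (first_passage \<omega>) + q) \<omega>) else 0)" for \<omega>
  have [measurable]: "(\<lambda>\<omega>. \<xi> (enn2real (first_passage \<omega>) + q) \<omega>) \<in> borel_measurable M"
    using q by (intro borel_measurable_random_time[where Y=\<xi> and R="\<lambda>\<omega>. enn2real (first_passage \<omega>) + q"]
        continuous_stopped) simp_all
  have [measurable]: "\<phi> \<in> borel_measurable M" unfolding \<phi>_def[abs_def] by measurable
  have \<phi>: "0 \<le> \<phi> \<omega>" "\<phi> \<omega> \<le> 1" for \<omega> by (auto simp: \<phi>_def indicator_def)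
  have int: "integrable M \<phi>" using \<phi> by (intro integrable_const_bound[of _ 1]) auto
  have f: "bounded_measurable (indicator {z})"
    by (auto simp: bounded_measurable_def indicator_def intro!: exI[of _ 1])
  have "AE \<omega> in M. first_passage \<omega> < \<infinity> \<longrightarrow>
      real_cond_exp M ?G \<phi> \<omega> = (\<integral>y. indicator {z} y \<partial>trans_kernel lam z q (\<xi> (enn2real (first_passage \<omega>)) \<omega>))"
    using sm[unfolded strong_markov_def, rule_format, OF stopping_time_first_passage q f]
    unfolding \<phi>_def[abs_def] .
  then have "AE \<omega> in M. real_cond_exp M ?G \<phi> \<omega> = 1"
    using AE_first_passage_finite AE_space
  proof eventually_elim
    case (elim \<omega>)
    from first_passage_attained[OF elim(3,2)] have "\<xi> (enn2real (first_passage \<omega>)) \<omega> = z" by auto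
    with elim q show ?case by (simp add: measure_trans_kernel_absorbed)
  qed
  \<comment> \<open>The conditional expectation preserves the integral, so \<open>\<phi>\<close> has
    mean 1; being at most 1, it equals 1 almost surely.\<close>
  then have "(\<integral>\<omega>. real_cond_exp M ?G \<phi> \<omega> \<partial>M) = (\<integral>\<omega>. 1 \<partial>M)"
    by (intro integral_cong_AE) auto
  then have "(\<integral>\<omega>. \<phi> \<omega> \<partial>M) = 1"
    using S.real_cond_exp_int(2)[OF int] by (simp add: prob_space)
  then have "(\<integral>\<omega>. 1 - \<phi> \<omega> \<partial>M) = 0" using int by (simp add: prob_space)
  then have "AE \<omega> in M. 1 - \<phi> \<omega> = 0"
    using int \<phi> by (subst (asm) integral_nonneg_eq_0_iff_AE) auto
  then show ?thesis
    by eventually_elim (auto simp: \<phi>_def indicator_def split: if_splits)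
qed

text \<open>Otherwise it would be a null event to be above \<open>z\<close> at time 1 and to visit
  \<open>z\<close> later. As \<open>hit_prob\<close> is positive, the drifted motion itself would
  then be at most \<open>z\<close> at time 1, against the positivity of the Gaussian
  density.\<close>

lemma stopped_exceeds_level: "\<not> (AE \<omega> in M. \<xi> 1 \<omega> \<le> z)"
proof
  assume ae: "AE \<omega> in M. \<xi> 1 \<omega> \<le> z"
  let ?A = "{\<omega>\<in>space (F 1). X 1 \<omega> > z}"
  have "X 1 \<in> borel_measurable (F 1)" by (intro measurable_X_F) auto
  then have A: "?A \<in> sets (F 1)" unfolding borel_measurable_iff_greater by blast
  have [measurable]: "?A \<in> events" using A by (rule sets_F_events)
  have [measurable]: "hits_after 1 \<in> events" "X 1 \<in> borel_measurable M" by (auto intro: sets_hits_after)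
  have "AE \<omega> in M. \<omega> \<notin> ?A \<inter> hits_after 1"
    using ae by eventually_elim (auto simp: stopped_eq_X)
  then have "emeasure M (?A \<inter> hits_after 1) = 0"
    by (subst (asm) AE_iff_measurable[of "?A \<inter> hits_after 1"]) (auto dest: sets.sets_into_space)
  then have "(\<integral>\<^sup>+ \<omega>. indicator ?A \<omega> * ennreal (hit_prob lam z (X 1 \<omega>)) \<partial>M) = 0"
    using emeasure_hits_after[OF _ A] by simp
  then have "AE \<omega> in M. indicator ?A \<omega> * ennreal (hit_prob lam z (X 1 \<omega>)) = 0"
    by (subst (asm) nn_integral_0_iff_AE) auto
  then have "AE \<omega> in M. X 1 \<omega> - X 0 \<omega> \<le> z"
    using AE_X_0 AE_space by eventually_elim (auto simp: indicator_def not_less split: if_splits)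
  then have "AE x in lborel. 0 < ennreal (normal_density (lam * (1 - 0)) (sqrt (1 - 0)) x) \<longrightarrow> x \<le> z"
    using distributed_AE2[OF distributed_increment[of 0 1], of "\<lambda>x. x \<le> z"] by simp
  then have "AE x in lborel. x \<le> z"
    by (auto simp: normal_density_pos)
  then have "emeasure lborel {x. \<not> x \<le> z} = 0"
    by (subst (asm) AE_iff_measurable[of "{x. \<not> x \<le> z}"]) (auto simp: not_le)
  moreover have "emeasure lborel {z<..<z + 1} \<le> emeasure lborel {x. \<not> x \<le> z}"
    by (rule emeasure_mono) (auto simp: not_le)
  ultimately show False by simp
qed

lemma not_strong_markov_stopped: "\<not> strong_markov M \<xi> (trans_kernel lam z)"
proof
  assume sm: "strong_markov M \<xi> (trans_kernel lam z)"
  \<comment> \<open>The exceptional set depends on the delay \<open>q\<close>, so only countably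
    many delays can be treated at once; continuity makes the rational ones sufficient.\<close>
  have "AE \<omega> in M. \<forall>q\<in>\<rat> \<inter> {0..}. \<xi> (enn2real (first_passage \<omega>) + q) \<omega> = z"
    using strong_markov_imp_absorbed[OF sm] by (intro AE_ball_countable[THEN iffD2]) (auto simp: countable_rat)
  then have "AE \<omega> in M. \<xi> 1 \<omega> \<le> z"
    using AE_stopped_eq_level AE_X_0 AE_space
  proof eventually_elim
    case (elim \<omega>)
    note \<omega> = \<open>\<omega> \<in> space M\<close>
    show ?case
    proof (rule ccontr)
      assume "\<not> \<xi> 1 \<omega> \<le> z"
      then have gt: "\<xi> 1 \<omega> > z" by simp
      have "\<xi> 0 \<omega> = 0" using elim stopped_eq_X[of 0 \<omega>] by simp
      then have "\<exists>t\<ge>0. t \<le> 1 \<and> \<xi> t \<omega> = z"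
        using gt z_pos by (intro IVT' continuous_on_subset[OF continuous_stopped[OF \<omega>]]) auto
      then have "first_passage \<omega> \<le> ennreal 1"
        by (auto intro: order_trans[OF first_passage_le] ennreal_leI)
      moreover from this have "first_passage \<omega> < \<infinity>" by (rule le_less_trans) simp
      ultimately obtain r where r: "r \<ge> 0" "first_passage \<omega> = ennreal r" "\<xi> r \<omega> = z" "r \<le> 1"
        using first_passage_attained[OF \<omega>] by auto
      have "\<exists>\<delta>>0. \<forall>s\<in>{0..}. \<bar>s - 1\<bar> < \<delta> \<longrightarrow> \<bar>\<xi> s \<omega> - \<xi> 1 \<omega>\<bar> < \<xi> 1 \<omega> - z"
        using continuous_stopped[OF \<omega>] gt unfolding continuous_on_iff dist_real_def by auto
      then obtain \<delta> where \<delta>: "\<delta> > 0" "\<And>s. s \<ge> 0 \<Longrightarrow> \<bar>s - 1\<bar> < \<delta> \<Longrightarrow> \<bar>\<xi> s \<omega> - \<xi> 1 \<omega>\<bar> < \<xi> 1 \<omega> - z"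
        by auto
      \<comment> \<open>The delay places \<open>r + q\<close> shortly after time 1, where the path
        by continuity is still above \<open>z\<close>, although absorption would put it at
        \<open>z\<close>.\<close>
      obtain q where q: "q \<in> \<rat>" "1 - r < q" "q < 1 - r + \<delta>"
        using Rats_dense_in_real[of "1 - r" "1 - r + \<delta>"] \<delta>(1) by auto
      then have "\<xi> (r + q) \<omega> = z" using elim(1) r by auto
      with \<delta>(2)[of "r + q"] q r show False by auto
    qed
  qed
  with stopped_exceeds_level show False ..
qed

end

theorem theorem2p1:
  fixes M :: "'a measure" and B :: "real \<Rightarrow> 'a \<Rightarrow> real" and lam z :: real
  assumes "prob_space M" and "complete_measure M"
    and "brownian_motion M B"
    and "lam > 0" and "z > 0"
  shows "markov_process M (stopped_process B lam z) (trans_kernel lam z) \<and>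
         \<not> strong_markov M (stopped_process B lam z) (trans_kernel lam z)"
proof -
  interpret prob_space M by fact
  interpret drifted_bm M B lam z by unfold_locales fact+
  show ?thesis using markov_process_stopped not_strong_markov_stopped ..
qed

end
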